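(* Let $\mathcal{B}$ be a bialgebra. Then $C_n^{(\mathbf{NC})}:=C_n^{(\mathbf N)}\cap C_n^{(\mathbf C)}$ and, if $\mathcal{B}$ is a $*$-bialgebra, $C_n^{(\mathbf{NCH})}:=C_n^{(\mathbf{NC})}\cap C_n^{(\mathbf H)}$ are cochain complexes with the coboundary operator $$\partial_n f(a_1,\dots,a_{n+1})=\delta(a_1)f(a_2,\dots,a_{n+1})+\sum_{i=1}^n(-1)^i f(a_1,\dots,a_ia_{i+1},\dots,a_{n+1})+(-1)^{n+1}f(a_1,\dots,a_n)\delta(a_{n+1}).$$
   Context: All vector spaces are over $\mathbb{C}$. $(\mathcal{B},\mu,\mathbf 1,\Delta,\delta)$: multiplication, unit, comultiplication, counit. $\mathcal{B}^{\otimes0}=\mathbb{C}$. $C_n=\{f:\mathcal{B}^{\otimes n}\to\mathbb{C}\mid f\text{ linear}\}$; $f(a_1,\dots,a_n)$ means $f(a_1\otimes\dots\otimes a_n)$. $\mu^{(n)}:\mathcal{B}^{\otimes n}\to\mathcal{B}$ is the multiplication of $n$ factors, $\mu^{(0)}(\lambda)=\lambda\mathbf 1$. For $f\in C_n$: $(f\star\mu^{(n)})(a_1\otimes\dots\otimes a_n)=f(a_1^{(1)}\otimes\dots\otimes a_n^{(1)})\,a_1^{(2)}\cdots a_n^{(2)}$ and $(\mu^{(n)}\star f)(a_1\otimes\dots\otimes a_n)=a_1^{(1)}\cdots a_n^{(1)}\,f(a_1^{(2)}\otimes\dots\otimes a_n^{(2)})$, where $\Delta a_i=a_i^{(1)}\otimes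 a_i^{(2)}$ (Sweedler). $C_n^{(\mathbf N)}=\{f\in C_n\mid f(\mathbf 1^{\otimes n})=0\}$; $C_n^{(\mathbf C)}=\{f\in C_n\mid f\star\mu^{(n)}=\mu^{(n)}\star f\}$. A $*$-bialgebra is a bialgebra with an involution $*$ making $(\mathcal{B},\mu,\mathbf 1,* )$ a $*$-algebra such that $\Delta,\delta$ are $*$-homomorphisms, where $(a\otimes b)^*=a^*\otimes b^*$. For a $*$-bialgebra and $f\in C_n$ put $\widetilde f(a_1\otimes\dots\otimes a_n)=\overline{f(a_n^*\otimes\dots\otimes a_1^* )}$ (for $n=0$: $\widetilde f(\lambda)=\overline{f(\overline\lambda)}$). $C_n^{(\mathbf H)}=\{f\in C_n\mid\widetilde f=f\}$ if $\lceil n/2\rceil$ is odd (i.e. $n=1,2,5,6,\dots$), and $C_n^{(\mathbf H)}=\{f\in C_n\mid\widetilde f=-f\}$ if $\lceil n/2\rceil$ is even (i.e. $n=0,3,4,7,8,\dots$). A cochain complex is a sequence of vector spaces $(D_n)_{n\in\mathbb{N}}$ (with $\mathbb{N}$ including $0$) with linear maps $\partial_n:D_n\to D_{n+1}$ such that $\partial_{n+1}\circ\partial_n=0$ for all $n\in\mathbb{N}$.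
   Formalization: The spaces C_n^(NCH) are shown to form a cochain complex of real, not complex, vector spaces: f ↦ f~ is conjugate-linear, so a nonzero f in C_n^(NCH) has i·f outside it, and the claim over the complex numbers fails. *)

theory Defs
  imports Complex_Main "HOL-Library.Poly_Mapping" "HOL-Library.Function_Algebras"
begin

section \<open>Complex vector spaces and unital associative algebras\<close>

class scaleC =
  fixes scaleC :: "complex \<Rightarrow> 'a \<Rightarrow> 'a"  (infixr \<open>*\<^sub>C\<close> 75)

class complex_vector = scaleC + ab_group_add +
  assumes scaleC_add_right: "c *\<^sub>C (x + y) = c *\<^sub>C x + c *\<^sub>C y"
    and scaleC_add_left: "(c + d) *\<^sub>C x = c *\<^sub>C x + d *\<^sub>C x"
    and scaleC_scaleC: "c *\<^sub>C d *\<^sub>C x = (c * d) *\<^sub>C x"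
    and scaleC_one: "1 *\<^sub>C x = x"

lemma vector_space_scaleC: "vector_space (scaleC :: complex \<Rightarrow> 'a \<Rightarrow> 'a::complex_vector)"
  by unfold_locales (simp_all add: scaleC_add_right scaleC_add_left scaleC_scaleC scaleC_one)

text \<open>\<open>ring_1\<close> includes \<open>0 \<noteq> 1\<close>. In a bialgebra this is automatic, since the counit maps \<open>1\<close> to \<open>1\<close>.\<close>

class complex_algebra_1 = complex_vector + ring_1 +
  assumes scaleC_mult_left: "(c *\<^sub>C x) * y = c *\<^sub>C (x * y)"
    and scaleC_mult_right: "x * (c *\<^sub>C y) = c *\<^sub>C (x * y)"

instantiation complex :: complex_algebra_1
begin
definition scaleC_complex :: "complex \<Rightarrow> complex \<Rightarrow> complex" where
  "scaleC_complex c z = c * z"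
instance
  by standard (simp_all add: scaleC_complex_def algebra_simps)
end

instantiation "fun" :: (type, complex_vector) complex_vector
begin
definition scaleC_fun :: "complex \<Rightarrow> ('a \<Rightarrow> 'b) \<Rightarrow> 'a \<Rightarrow> 'b" where
  "scaleC_fun c f = (\<lambda>x. c *\<^sub>C f x)"
instance
  by standard (simp_all add: scaleC_fun_def fun_eq_iff scaleC_add_right scaleC_add_left scaleC_scaleC scaleC_one)
end

abbreviation clinear :: "('a::complex_vector \<Rightarrow> 'b::complex_vector) \<Rightarrow> bool" where
  "clinear \<equiv> Vector_Spaces.linear scaleC scaleC"

lemma scaleC_zero_left [simp]: "0 *\<^sub>C x = (0 :: 'a::complex_vector)"
  using scaleC_add_left [of 0 0 x] by simp

lemma scaleC_zero_right [simp]: "c *\<^sub>C 0 = (0 :: 'a::complex_vector)"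
  using scaleC_add_right [of c 0 0] by simp

lemma scaleC_minus_right: "c *\<^sub>C (- x) = - (c *\<^sub>C (x :: 'a::complex_vector))"
  using scaleC_add_right [of c x "- x"] by (simp add: eq_neg_iff_add_eq_0 add.commute)

lemma scaleC_diff_right: "c *\<^sub>C (x - y) = c *\<^sub>C x - c *\<^sub>C (y :: 'a::complex_vector)"
  using scaleC_add_right [of c x "- y"] by (simp add: scaleC_minus_right)


section \<open>Tensor powers\<close>

text \<open>
  The tensor algebra \<open>T(V) = (\<Oplus>n. V\<^sup>\<otimes>\<^sup>n)\<close> is the free vector space on words over \<open>V\<close>, modulo the
  subspace generated by the multilinearity relations. Since these relations are homogeneous, the
  \<open>n\<close>-th tensor power of \<open>V\<close> is the span of the words of length \<open>n\<close>; the empty word spans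
  \<open>V\<^sup>\<otimes>\<^sup>0 = \<complex>\<close>. The generators below are already closed under scaling.
\<close>

inductive_set tens_null :: "('a::complex_vector list \<Rightarrow>\<^sub>0 complex) set" where
  tens_null_zero: "0 \<in> tens_null"
| tens_null_add: "p \<in> tens_null \<Longrightarrow> q \<in> tens_null \<Longrightarrow> p + q \<in> tens_null"
| tens_null_uminus: "p \<in> tens_null \<Longrightarrow> - p \<in> tens_null"
| tens_null_gen_add: "Poly_Mapping.single (u @ (a + b) # v) c
    - Poly_Mapping.single (u @ a # v) c - Poly_Mapping.single (u @ b # v) c \<in> tens_null"
| tens_null_gen_scale: "Poly_Mapping.single (u @ (k *\<^sub>C a) # v) c
    - Poly_Mapping.single (u @ a # v) (k * c) \<in> tens_null"

definition tens_rel :: "('a::complex_vector list \<Rightarrow>\<^sub>0 complex) \<Rightarrow> ('a list \<Rightarrow>\<^sub>0 complex) \<Rightarrow> bool" where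
  "tens_rel p q \<longleftrightarrow> p - q \<in> tens_null"

lemma equivp_tens_rel: "equivp (tens_rel :: ('a::complex_vector list \<Rightarrow>\<^sub>0 complex) \<Rightarrow> _)"
proof (rule equivpI)
  show "reflp (tens_rel :: ('a list \<Rightarrow>\<^sub>0 complex) \<Rightarrow> _)"
    by (simp add: reflp_def tens_rel_def tens_null_zero)
  show "symp (tens_rel :: ('a list \<Rightarrow>\<^sub>0 complex) \<Rightarrow> _)"
  proof (rule sympI)
    fix p q :: "'a list \<Rightarrow>\<^sub>0 complex"
    assume "tens_rel p q"
    then have "- (p - q) \<in> tens_null" unfolding tens_rel_def by (rule tens_null_uminus)
    then show "tens_rel q p" by (simp add: tens_rel_def)
  qed
  show "transp (tens_rel :: ('a list \<Rightarrow>\<^sub>0 complex) \<Rightarrow> _)"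
  proof (rule transpI)
    fix p q r :: "'a list \<Rightarrow>\<^sub>0 complex"
    assume "tens_rel p q" "tens_rel q r"
    then have "(p - q) + (q - r) \<in> tens_null" unfolding tens_rel_def by (rule tens_null_add)
    then show "tens_rel p r" by (simp add: tens_rel_def)
  qed
qed

quotient_type (overloaded) 'a tens = "'a::complex_vector list \<Rightarrow>\<^sub>0 complex" / tens_rel
  by (rule equivp_tens_rel)

lemma lookup_map_times: "Poly_Mapping.lookup (Poly_Mapping.map ((*) (c::complex)) p) k = c * Poly_Mapping.lookup p k"
  by (simp add: Poly_Mapping.map.rep_eq when_def)

lemma map_times_zero: "Poly_Mapping.map ((*) (c::complex)) 0 = 0"
  by (rule poly_mapping_eqI) (simp add: lookup_map_times)

lemma map_times_add:
  "Poly_Mapping.map ((*) (c::complex)) (p + q) = Poly_Mapping.map ((*) c) p + Poly_Mapping.map ((*) c) q"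
  by (rule poly_mapping_eqI) (simp add: lookup_add lookup_map_times algebra_simps)

lemma map_times_uminus:
  "Poly_Mapping.map ((*) (c::complex)) (- p) = - Poly_Mapping.map ((*) c) p"
  by (rule poly_mapping_eqI) (simp add: lookup_map_times)

lemma map_times_diff:
  "Poly_Mapping.map ((*) (c::complex)) (p - q) = Poly_Mapping.map ((*) c) p - Poly_Mapping.map ((*) c) q"
  by (rule poly_mapping_eqI) (simp add: lookup_minus lookup_map_times algebra_simps)

lemma tens_null_map: "p \<in> tens_null \<Longrightarrow> Poly_Mapping.map ((*) c) p \<in> tens_null"
proof (induction rule: tens_null.induct)
  case tens_null_zero
  show ?case by (simp add: map_times_zero tens_null.tens_null_zero)
next
  case (tens_null_gen_scale u k a v d)
  then show ?case
    using tens_null.tens_null_gen_scale[of u k a v "c * d"]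
    by (simp add: map_times_diff mult.left_commute)
qed (simp_all add: map_times_add map_times_uminus map_times_diff tens_null.intros)

instantiation tens :: (complex_vector) complex_vector
begin

lift_definition zero_tens :: "'a tens" is 0 .

lift_definition plus_tens :: "'a tens \<Rightarrow> 'a tens \<Rightarrow> 'a tens" is "(+)"
  unfolding tens_rel_def by (subst add_diff_add) (rule tens_null_add)

lift_definition uminus_tens :: "'a tens \<Rightarrow> 'a tens" is uminus
  unfolding tens_rel_def by (subst minus_diff_minus) (rule tens_null_uminus)

lift_definition minus_tens :: "'a tens \<Rightarrow> 'a tens \<Rightarrow> 'a tens" is "(-)"
proof -
  fix p q p' q' :: "'a list \<Rightarrow>\<^sub>0 complex"
  assume "tens_rel p q" "tens_rel p' q'"
  then have "(p - q) + - (p' - q') \<in> tens_null"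
    unfolding tens_rel_def by (intro tens_null_add tens_null_uminus)
  then show "tens_rel (p - p') (q - q')" by (simp add: tens_rel_def algebra_simps)
qed

lift_definition scaleC_tens :: "complex \<Rightarrow> 'a tens \<Rightarrow> 'a tens" is
  "\<lambda>c. Poly_Mapping.map ((*) c)"
  unfolding tens_rel_def by (subst map_times_diff [symmetric]) (rule tens_null_map)

instance
proof
  fix x y z :: "'a tens" and c d :: complex
  have refl: "p = q \<Longrightarrow> tens_rel p q" for p q :: "'a list \<Rightarrow>\<^sub>0 complex"
    by (simp add: tens_rel_def tens_null_zero)
  show "x + y + z = x + (y + z)" by transfer (rule refl, simp add: add.assoc)
  show "x + y = y + x" by transfer (rule refl, simp add: add.commute)
  show "0 + x = x" by transfer (rule refl, simp)
  show "- x + x = 0" by transfer (rule refl, simp)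
  show "x - y = x + - y" by transfer (rule refl, simp)
  show "c *\<^sub>C (x + y) = c *\<^sub>C x + c *\<^sub>C y" by transfer (rule refl, simp add: map_times_add)
  show "(c + d) *\<^sub>C x = c *\<^sub>C x + d *\<^sub>C x"
    by transfer (rule refl, rule poly_mapping_eqI,
      simp add: lookup_add lookup_map_times algebra_simps)
  show "c *\<^sub>C d *\<^sub>C x = (c * d) *\<^sub>C x"
    by transfer (rule refl, rule poly_mapping_eqI, simp add: lookup_map_times)
  show "1 *\<^sub>C x = x"
    by transfer (rule refl, rule poly_mapping_eqI, simp add: lookup_map_times)
qed

end

text \<open>\<open>pure [a\<^sub>1, \<dots>, a\<^sub>n]\<close> is the elementary tensor \<open>a\<^sub>1 \<otimes> \<dots> \<otimes> a\<^sub>n\<close>.\<close>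

lift_definition pure :: "'a::complex_vector list \<Rightarrow> 'a tens" is "\<lambda>w. Poly_Mapping.single w 1" .

definition tpow :: "nat \<Rightarrow> 'a::complex_vector tens set" where
  "tpow n = module.span scaleC {pure w |w. length w = n}"

lemma pure_add: "pure (u @ (a + b) # v) = pure (u @ a # v) + pure (u @ b # v)"
  by transfer (simp add: tens_rel_def tens_null_gen_add flip: diff_diff_eq)

lemma pure_scaleC: "pure (u @ (k *\<^sub>C a) # v) = k *\<^sub>C pure (u @ a # v)"
proof (transfer fixing: k)
  fix u v :: "'a list" and a :: 'a
  show "tens_rel (Poly_Mapping.single (u @ (k *\<^sub>C a) # v) 1)
      (Poly_Mapping.map ((*) k) (Poly_Mapping.single (u @ a # v) 1))"
    using tens_null_gen_scale [of u k a v 1] by (simp add: tens_rel_def)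
qed


text \<open>
  \<open>lift_along \<sigma> n F\<close> is the \<open>\<sigma>\<close>-semilinear map on \<open>V\<^sup>\<otimes>\<^sup>n\<close> sending \<open>a\<^sub>1 \<otimes> \<dots> \<otimes> a\<^sub>n\<close> to
  \<open>F [a\<^sub>1, \<dots>, a\<^sub>n]\<close>, extended by zero to the other summands of the tensor algebra. It is only used
  for \<open>F\<close> that are \<open>\<sigma>\<close>-semilinear in each of the \<open>n\<close> entries (see \<open>lift_along_pure\<close>).
\<close>

definition semilinear ::
    "(complex \<Rightarrow> complex) \<Rightarrow> ('a::complex_vector \<Rightarrow> 'b::complex_vector) \<Rightarrow> bool" where
  "semilinear \<sigma> g \<longleftrightarrow> (\<forall>x y. g (x + y) = g x + g y) \<and> (\<forall>c x. g (c *\<^sub>C x) = \<sigma> c *\<^sub>C g x)"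

definition multi_semilinear ::
    "(complex \<Rightarrow> complex) \<Rightarrow> nat \<Rightarrow> ('a::complex_vector list \<Rightarrow> 'b::complex_vector) \<Rightarrow> bool" where
  "multi_semilinear \<sigma> n F \<longleftrightarrow>
    (\<forall>u v. length u + length v + 1 = n \<longrightarrow> semilinear \<sigma> (\<lambda>a. F (u @ a # v)))"

definition lift_along ::
    "(complex \<Rightarrow> complex) \<Rightarrow> nat \<Rightarrow> ('a::complex_vector list \<Rightarrow> 'b::complex_vector) \<Rightarrow> 'a tens \<Rightarrow> 'b" where
  "lift_along \<sigma> n F =
    (THE g. semilinear \<sigma> g \<and> (\<forall>w. g (pure w) = (if length w = n then F w else 0)))"

abbreviation tlift :: "nat \<Rightarrow> ('a::complex_vector list \<Rightarrow> 'b::complex_vector) \<Rightarrow> 'a tens \<Rightarrow> 'b" where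
  "tlift \<equiv> lift_along (\<lambda>c. c)"

abbreviation tlift_cnj :: "nat \<Rightarrow> ('a::complex_vector list \<Rightarrow> 'b::complex_vector) \<Rightarrow> 'a tens \<Rightarrow> 'b" where
  "tlift_cnj \<equiv> lift_along cnj"

lemma poly_mapping_single_induct:
  fixes p :: "'a \<Rightarrow>\<^sub>0 'b::comm_monoid_add"
  assumes "P 0" and "\<And>w c. P (Poly_Mapping.single w c)" and "\<And>p q. P p \<Longrightarrow> P q \<Longrightarrow> P (p + q)"
  shows "P p"
proof (induction p rule: update_induct)
  case const
  show ?case by (rule assms(1))
next
  case (update p k v)
  have "Poly_Mapping.update k v p = p + Poly_Mapping.single k v"
    using update(1)
    by (intro poly_mapping_eqI)
      (auto simp: lookup_update lookup_add lookup_single when_def not_in_keys_iff_lookup_eq_zero)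
  then show ?case using assms update by simp
qed

lemma abs_rep_tens: "abs_tens (rep_tens x) = x"
  by (rule Quotient_abs_rep [OF Quotient_tens])

lemma tens_induct:
  assumes add: "\<And>x y. P x \<Longrightarrow> P y \<Longrightarrow> P (x + y)" and pure: "\<And>c w. P (c *\<^sub>C pure w)"
  shows "P x"
proof -
  have "P (abs_tens p)" for p
  proof (induction p rule: poly_mapping_single_induct)
    case 1
    have "P (0 *\<^sub>C pure [])" by (rule pure)
    then show ?case by (simp add: zero_tens_def)
  next
    case (2 w c)
    have "abs_tens (Poly_Mapping.single w c) = c *\<^sub>C pure w"
      by (simp add: pure_def scaleC_tens.abs_eq)
    then show ?case using pure by simp
  next
    case (3 p q)
    then show ?case by (simp add: add plus_tens.abs_eq [symmetric])
  qed
  from this [of "rep_tens x"] show ?thesis by (simp add: abs_rep_tens)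
qed

lemma semilinear_unique:
  assumes "semilinear \<sigma> g" "semilinear \<sigma> h" "\<And>w. g (pure w) = h (pure w)"
  shows "g = h"
proof
  show "g x = h x" for x
    by (induction x rule: tens_induct) (use assms in \<open>simp_all add: semilinear_def\<close>)
qed

lemma lift_along_exists:
  fixes F :: "'a::complex_vector list \<Rightarrow> 'b::complex_vector"
  assumes F: "multi_semilinear \<sigma> n F"
    and \<sigma>: "\<sigma> 1 = 1" "\<And>c d. \<sigma> (c + d) = \<sigma> c + \<sigma> d" "\<And>c d. \<sigma> (c * d) = \<sigma> c * \<sigma> d"
  shows "\<exists>g. semilinear \<sigma> g \<and> (\<forall>w. g (pure w) = (if length w = n then F w else 0))"
proof -
  define G where "G w = (if length w = n then F w else 0)" for w
  define S where "S p = (\<Sum>w\<in>Poly_Mapping.keys p. \<sigma> (Poly_Mapping.lookup p w) *\<^sub>C G w)" for p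
  have \<sigma>0: "\<sigma> 0 = 0" using \<sigma>(2)[of 0 0] by simp
  have S_add: "S (p + q) = S p + S q" for p q
    unfolding S_def by (rule setsum_keys_plus_distrib) (simp_all add: \<sigma>0 \<sigma>(2) scaleC_add_left)
  have S0: "S 0 = 0" by (simp add: S_def)
  have S_uminus: "S (- p) = - S p" for p
    using S_add[of p "- p"] S0 by (simp add: add_eq_0_iff)
  have S_diff: "S (p - q) = S p - S q" for p q
    using S_add[of p "- q"] by (simp add: S_uminus)
  have S_single: "S (Poly_Mapping.single w c) = \<sigma> c *\<^sub>C G w" for w c
    by (simp add: S_def \<sigma>0)
  have S_map: "S (Poly_Mapping.map ((*) c) p) = \<sigma> c *\<^sub>C S p" for c p
  proof (induction p rule: poly_mapping_single_induct)
    case 1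
    show ?case by (simp add: map_times_zero S0)
  qed (simp_all add: map_times_add S_add scaleC_add_right S_single scaleC_scaleC \<sigma>(3))
  have G_add: "G (u @ (a + b) # v) = G (u @ a # v) + G (u @ b # v)" for u v a b
    using F by (auto simp: G_def multi_semilinear_def semilinear_def)
  have G_scale: "G (u @ (k *\<^sub>C a) # v) = \<sigma> k *\<^sub>C G (u @ a # v)" for u v a k
    using F by (auto simp: G_def multi_semilinear_def semilinear_def)
  have S_null: "S p = 0" if "p \<in> tens_null" for p
    using that
    by (induction rule: tens_null.induct)
      (simp_all add: S0 S_add S_uminus S_diff S_single G_add G_scale scaleC_add_right
        scaleC_scaleC \<sigma>(3) mult.commute)
  define g where "g x = S (rep_tens x)" for x
  have g_abs: "g (abs_tens p) = S p" for p
  proof -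
    have "tens_rel (rep_tens (abs_tens p)) p"
      by (rule Quotient_rep_abs [OF Quotient_tens]) (simp add: tens_rel_def tens_null_zero)
    then have "S (rep_tens (abs_tens p) - p) = 0"
      unfolding tens_rel_def by (rule S_null)
    then show ?thesis by (simp add: g_def S_diff)
  qed
  have "g (x + y) = g x + g y" for x y
    using g_abs [of "rep_tens x + rep_tens y"]
    by (simp add: plus_tens.abs_eq [symmetric] abs_rep_tens S_add) (simp add: g_def)
  moreover have "g (c *\<^sub>C x) = \<sigma> c *\<^sub>C g x" for c x
    using g_abs [of "Poly_Mapping.map ((*) c) (rep_tens x)"]
    by (simp add: scaleC_tens.abs_eq [symmetric] abs_rep_tens S_map) (simp add: g_def)
  moreover have "g (pure w) = G w" for w
    by (simp add: pure_def g_abs S_single \<sigma>(1) scaleC_one)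
  ultimately show ?thesis
    unfolding semilinear_def G_def by blast
qed

lemma
  assumes "multi_semilinear \<sigma> n F" "\<sigma> = (\<lambda>c. c) \<or> \<sigma> = cnj"
  shows semilinear_lift_along: "semilinear \<sigma> (lift_along \<sigma> n F)"
    and lift_along_pure: "lift_along \<sigma> n F (pure w) = (if length w = n then F w else 0)"
proof -
  have "\<exists>!g. semilinear \<sigma> g \<and> (\<forall>w. g (pure w) = (if length w = n then F w else 0))"
  proof (rule ex_ex1I)
    show "\<exists>g. semilinear \<sigma> g \<and> (\<forall>w. g (pure w) = (if length w = n then F w else 0))"
      by (rule lift_along_exists) (use assms in auto)
  qed (auto intro: semilinear_unique)
  from theI'[OF this] show "semilinear \<sigma> (lift_along \<sigma> n F)"
    and "lift_along \<sigma> n F (pure w) = (if length w = n then F w else 0)"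
    unfolding lift_along_def by blast+
qed


lemma semilinear_add: "semilinear \<sigma> g \<Longrightarrow> semilinear \<sigma> h \<Longrightarrow> semilinear \<sigma> (\<lambda>a. g a + h a)"
  by (simp add: semilinear_def scaleC_add_right algebra_simps)

lemma semilinear_cmult: "semilinear \<sigma> g \<Longrightarrow> semilinear \<sigma> (\<lambda>a. (k::complex) * g a)"
  by (simp add: semilinear_def scaleC_complex_def algebra_simps)

lemma semilinear_cmult_right: "semilinear \<sigma> g \<Longrightarrow> semilinear \<sigma> (\<lambda>a. g a * (k::complex))"
  by (simp add: semilinear_def scaleC_complex_def algebra_simps)

lemma semilinear_sum:
  "(\<And>i. i \<in> A \<Longrightarrow> semilinear \<sigma> (g i)) \<Longrightarrow> semilinear \<sigma> (\<lambda>a. \<Sum>i\<in>A. g i a)"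
proof (induction A rule: infinite_finite_induct)
  case (insert x F)
  then show ?case using semilinear_add [of \<sigma> "g x" "\<lambda>a. \<Sum>i\<in>F. g i a"] by simp
qed (simp_all add: semilinear_def)

lemma semilinear_clinear: "clinear g \<Longrightarrow> semilinear (\<lambda>c. c) g"
  by (simp add: semilinear_def Vector_Spaces.linear_iff)

lemma semilinear_pure:
  assumes "clinear f" "semilinear (\<lambda>c. c) h"
  shows "semilinear (\<lambda>c. c) (\<lambda>a. f (pure (u @ h a # v)))"
  using assms by (simp add: semilinear_def Vector_Spaces.linear_iff pure_add pure_scaleC)


section \<open>Bialgebras\<close>

text \<open>The comultiplication \<open>\<Delta>\<close> takes values in \<open>\<B> \<otimes> \<B> = tpow 2\<close>; the tensors below live in \<open>tpow 3\<close> and \<open>tpow 2\<close>.\<close>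

definition comult_left :: "('b::complex_vector \<Rightarrow> 'b tens) \<Rightarrow> 'b tens \<Rightarrow> 'b tens" where
  "comult_left \<Delta> = tlift 2 (\<lambda>u. tlift 2 (\<lambda>v. pure [v ! 0, v ! 1, u ! 1]) (\<Delta> (u ! 0)))"  \<comment> \<open>\<open>\<Delta> \<otimes> id\<close>\<close>

definition comult_right :: "('b::complex_vector \<Rightarrow> 'b tens) \<Rightarrow> 'b tens \<Rightarrow> 'b tens" where
  "comult_right \<Delta> = tlift 2 (\<lambda>u. tlift 2 (\<lambda>v. pure [u ! 0, v ! 0, v ! 1]) (\<Delta> (u ! 1)))"  \<comment> \<open>\<open>id \<otimes> \<Delta>\<close>\<close>

definition tmult2 :: "'b::complex_algebra_1 tens \<Rightarrow> 'b tens \<Rightarrow> 'b tens" where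
  "tmult2 x y = tlift 2 (\<lambda>u. tlift 2 (\<lambda>v. pure [u ! 0 * v ! 0, u ! 1 * v ! 1]) y) x"

locale bialgebra =
  fixes \<Delta> :: "'b::complex_algebra_1 \<Rightarrow> 'b tens" and \<delta> :: "'b \<Rightarrow> complex"
  assumes comult_linear: "clinear \<Delta>"
    and comult_range: "\<Delta> a \<in> tpow 2"
    and counit_linear: "clinear \<delta>"
    and coassoc: "comult_left \<Delta> (\<Delta> a) = comult_right \<Delta> (\<Delta> a)"
    and counit_left: "tlift 2 (\<lambda>u. \<delta> (u ! 0) *\<^sub>C u ! 1) (\<Delta> a) = a"
    and counit_right: "tlift 2 (\<lambda>u. \<delta> (u ! 1) *\<^sub>C u ! 0) (\<Delta> a) = a"
    and comult_one: "\<Delta> 1 = pure [1, 1]"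
    and comult_mult: "\<Delta> (a * b) = tmult2 (\<Delta> a) (\<Delta> b)"
    and counit_one: "\<delta> 1 = 1"
    and counit_mult: "\<delta> (a * b) = \<delta> a * \<delta> b"

locale star_bialgebra = bialgebra \<Delta> \<delta>
  for \<Delta> :: "'b::complex_algebra_1 \<Rightarrow> 'b tens" and \<delta> :: "'b \<Rightarrow> complex" +
  fixes star :: "'b \<Rightarrow> 'b"
  assumes star_star: "star (star a) = a"
    and star_add: "star (a + b) = star a + star b"
    and star_scaleC: "star (c *\<^sub>C a) = cnj c *\<^sub>C star a"
    and star_mult: "star (a * b) = star b * star a"
    and comult_star: "\<Delta> (star a) = tlift_cnj 2 (\<lambda>u. pure [star (u ! 0), star (u ! 1)]) (\<Delta> a)"
    and counit_star: "\<delta> (star a) = cnj (\<delta> a)"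


section \<open>Cochains\<close>

text \<open>
  A linear functional on \<open>\<B>\<^sup>\<otimes>\<^sup>n\<close> is represented by its extension by zero to the other summands of
  the tensor algebra.
\<close>

definition cochains :: "nat \<Rightarrow> ('b::complex_vector tens \<Rightarrow> complex) set" where
  "cochains n = {f. clinear f \<and> (\<forall>m x. m \<noteq> n \<longrightarrow> x \<in> tpow m \<longrightarrow> f x = 0)}"

definition mu :: "nat \<Rightarrow> 'b::complex_algebra_1 tens \<Rightarrow> 'b" where
  "mu n = tlift n prod_list"

text \<open>
  \<open>sweedler \<Delta> [a\<^sub>1, \<dots>, a\<^sub>n] G\<close> is \<open>G [a\<^sub>1\<^sup>(\<^sup>1\<^sup>), \<dots>, a\<^sub>n\<^sup>(\<^sup>1\<^sup>)] [a\<^sub>1\<^sup>(\<^sup>2\<^sup>), \<dots>, a\<^sub>n\<^sup>(\<^sup>2\<^sup>)]\<close> in Sweedler notation (with the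
  implicit summations), for \<open>G\<close> linear in each of the \<open>2n\<close> entries.
\<close>

fun sweedler ::
    "('b::complex_vector \<Rightarrow> 'b tens) \<Rightarrow> 'b list \<Rightarrow> ('b list \<Rightarrow> 'b list \<Rightarrow> 'v::complex_vector) \<Rightarrow> 'v" where
  "sweedler \<Delta> [] G = G [] []"
| "sweedler \<Delta> (a # as) G =
     tlift 2 (\<lambda>u. sweedler \<Delta> as (\<lambda>bs cs. G (u ! 0 # bs) (u ! 1 # cs))) (\<Delta> a)"

definition conv_mu :: "('b::complex_algebra_1 \<Rightarrow> 'b tens) \<Rightarrow> nat \<Rightarrow> ('b tens \<Rightarrow> complex) \<Rightarrow> 'b tens \<Rightarrow> 'b" where
  "conv_mu \<Delta> n f = tlift n (\<lambda>as. sweedler \<Delta> as (\<lambda>bs cs. f (pure bs) *\<^sub>C mu n (pure cs)))"  \<comment> \<open>\<open>f \<star> \<mu>\<^sup>(\<^sup>n\<^sup>)\<close>\<close>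

definition mu_conv :: "('b::complex_algebra_1 \<Rightarrow> 'b tens) \<Rightarrow> nat \<Rightarrow> ('b tens \<Rightarrow> complex) \<Rightarrow> 'b tens \<Rightarrow> 'b" where
  "mu_conv \<Delta> n f = tlift n (\<lambda>as. sweedler \<Delta> as (\<lambda>bs cs. f (pure cs) *\<^sub>C mu n (pure bs)))"  \<comment> \<open>\<open>\<mu>\<^sup>(\<^sup>n\<^sup>) \<star> f\<close>\<close>

definition tilde :: "('b::complex_vector \<Rightarrow> 'b) \<Rightarrow> nat \<Rightarrow> ('b tens \<Rightarrow> complex) \<Rightarrow> 'b tens \<Rightarrow> complex" where
  "tilde star n f = tlift n (\<lambda>as. cnj (f (pure (map star (rev as)))))"

definition cochains_N :: "nat \<Rightarrow> ('b::complex_algebra_1 tens \<Rightarrow> complex) set" where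
  "cochains_N n = {f \<in> cochains n. f (pure (replicate n 1)) = 0}"

definition cochains_C ::
    "('b::complex_algebra_1 \<Rightarrow> 'b tens) \<Rightarrow> nat \<Rightarrow> ('b tens \<Rightarrow> complex) set" where
  "cochains_C \<Delta> n = {f \<in> cochains n. conv_mu \<Delta> n f = mu_conv \<Delta> n f}"

definition cochains_H :: "('b::complex_vector \<Rightarrow> 'b) \<Rightarrow> nat \<Rightarrow> ('b tens \<Rightarrow> complex) set" where
  "cochains_H star n =
    {f \<in> cochains n. tilde star n f = (if odd \<lceil>real n / 2\<rceil> then f else - f)}"

definition cochains_NC ::
    "('b::complex_algebra_1 \<Rightarrow> 'b tens) \<Rightarrow> nat \<Rightarrow> ('b tens \<Rightarrow> complex) set" where
  "cochains_NC \<Delta> n = cochains_N n \<inter> cochains_C \<Delta> n"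

definition cochains_NCH ::
    "('b::complex_algebra_1 \<Rightarrow> 'b tens) \<Rightarrow> ('b \<Rightarrow> 'b) \<Rightarrow> nat \<Rightarrow> ('b tens \<Rightarrow> complex) set" where
  "cochains_NCH \<Delta> star n = cochains_NC \<Delta> n \<inter> cochains_H star n"

text \<open>In the sum, \<open>as ! (i - 1) = a\<^sub>i\<close>: the entries \<open>a\<^sub>i\<close> and \<open>a\<^sub>i\<^sub>+\<^sub>1\<close> are replaced by their product.\<close>

definition coboundary ::
    "('b::complex_algebra_1 \<Rightarrow> complex) \<Rightarrow> nat \<Rightarrow> ('b tens \<Rightarrow> complex) \<Rightarrow> 'b tens \<Rightarrow> complex" where
  "coboundary \<delta> n f = tlift (n + 1) (\<lambda>as.
      \<delta> (hd as) * f (pure (tl as))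
    + (\<Sum>i = 1..n. (- 1) ^ i * f (pure (take (i - 1) as @ (as ! (i - 1) * as ! i) # drop (i + 1) as)))
    + (- 1) ^ (n + 1) * f (pure (butlast as)) * \<delta> (last as))"


lemma coboundary_pure:
  assumes \<delta>: "clinear \<delta>" and f: "f \<in> cochains n" and len: "length as = n + 1"
  shows "coboundary \<delta> n f (pure as) =
      \<delta> (hd as) * f (pure (tl as))
    + (\<Sum>i = 1..n. (- 1) ^ i * f (pure (take (i - 1) as @ (as ! (i - 1) * as ! i) # drop (i + 1) as)))
    + (- 1) ^ (n + 1) * f (pure (butlast as)) * \<delta> (last as)"
proof -
  have lf: "clinear f" using f by (simp add: cochains_def)
  note sl = semilinear_add semilinear_cmult semilinear_cmult_right semilinear_sum semilinear_pure [OF lf]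
  note sd = semilinear_clinear [OF \<delta>]
  have id: "semilinear (\<lambda>c. c) (\<lambda>a. a)" by (simp add: semilinear_def)
  have ml: "semilinear (\<lambda>c. c) (\<lambda>a. b * a)" "semilinear (\<lambda>c. c) (\<lambda>a. a * b)" for b :: 'a
    by (simp_all add: semilinear_def scaleC_mult_left scaleC_mult_right algebra_simps)
  have 1: "semilinear (\<lambda>c. c) (\<lambda>a. \<delta> (hd (u @ a # v)) * f (pure (tl (u @ a # v))))" for u v
    by (cases u) (auto intro!: semilinear_cmult semilinear_cmult_right semilinear_pure [OF lf] sd id)
  have 3: "semilinear (\<lambda>c. c) (\<lambda>a. (- 1) ^ (n + 1) * f (pure (butlast (u @ a # v))) * \<delta> (last (u @ a # v)))" for u v
  proof (cases v rule: rev_cases)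
    case Nil
    have e: "butlast (u @ [a]) = u" "last (u @ [a]) = a" for a by simp_all
    show ?thesis unfolding Nil e by (intro semilinear_cmult sd)
  next
    case (snoc v' z)
    have e: "butlast (u @ a # v' @ [z]) = u @ a # v'" "last (u @ a # v' @ [z]) = z" for a
      by (simp_all add: butlast_append)
    show ?thesis unfolding snoc e by (intro semilinear_cmult_right semilinear_cmult sl id)
  qed
  have 2: "semilinear (\<lambda>c. c) (\<lambda>a. f (pure (take (i - 1) (u @ a # v) @
        ((u @ a # v) ! (i - 1) * (u @ a # v) ! i) # drop (i + 1) (u @ a # v))))"
    if i: "1 \<le> i" "i \<le> length u + length v" for u v i
  proof -
    consider "i < length u" | "i = length u" | "i = length u + 1" | "i > length u + 1" by linarith
    then show ?thesis
    proof cases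
      case 1
      then have "i - 1 < length u" by simp
      with 1 have e: "take (i - 1) (u @ a # v) @ ((u @ a # v) ! (i - 1) * (u @ a # v) ! i) # drop (i + 1) (u @ a # v)
        = (take (i - 1) u @ (u ! (i - 1) * u ! i) # drop (i + 1) u) @ a # v" for a
        by (simp add: nth_append)
      show ?thesis unfolding e by (rule semilinear_pure [OF lf id])
    next
      case 2
      then have "i - 1 < length u" using i by simp
      with 2 have e: "take (i - 1) (u @ a # v) @ ((u @ a # v) ! (i - 1) * (u @ a # v) ! i) # drop (i + 1) (u @ a # v)
        = take (i - 1) u @ (u ! (i - 1) * a) # v" for a
        using i by (simp add: nth_append)
      show ?thesis unfolding e by (rule semilinear_pure [OF lf ml(1)])
    next
      case 3
      then have e: "take (i - 1) (u @ a # v) @ ((u @ a # v) ! (i - 1) * (u @ a # v) ! i) # drop (i + 1) (u @ a # v)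
        = u @ (a * v ! 0) # drop 1 v" for a
        using i by (simp add: nth_append)
      show ?thesis unfolding e by (rule semilinear_pure [OF lf ml(2)])
    next
      case 4
      then have "length u + 2 \<le> i" by simp
      then obtain j where j: "i = length u + 2 + j" using le_Suc_ex by blast
      then have e: "take (i - 1) (u @ a # v) @ ((u @ a # v) ! (i - 1) * (u @ a # v) ! i) # drop (i + 1) (u @ a # v)
        = u @ a # (take j v @ (v ! j * v ! (j + 1)) # drop (j + 2) v)" for a
        by (simp add: nth_append numeral_3_eq_3)
      show ?thesis unfolding e by (rule semilinear_pure [OF lf id])
    qed
  qed
  show ?thesis
    unfolding coboundary_def
  proof (subst lift_along_pure)
    show "multi_semilinear (\<lambda>c. c) (n + 1) (\<lambda>as. \<delta> (hd as) * f (pure (tl as))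
      + (\<Sum>i = 1..n. (- 1) ^ i * f (pure (take (i - 1) as @ (as ! (i - 1) * as ! i) # drop (i + 1) as)))
      + (- 1) ^ (n + 1) * f (pure (butlast as)) * \<delta> (last as))"
      unfolding multi_semilinear_def
      by (intro allI impI semilinear_add semilinear_sum semilinear_cmult 1 2 3) auto
  qed (use len in auto)
qed


section \<open>Cochain complexes\<close>

text \<open>
  The spaces are subspaces of one ambient vector space. The field of scalars is a parameter because
  \<open>f \<mapsto> tilde star n f\<close> is conjugate-linear, so that \<open>cochains_H star n\<close> is a vector space only over
  the real numbers.
\<close>

locale cochain_complex = vector_space scale
  for scale :: "'k::field \<Rightarrow> 'v::ab_group_add \<Rightarrow> 'v" +
  fixes D :: "nat \<Rightarrow> 'v set" and d :: "nat \<Rightarrow> 'v \<Rightarrow> 'v"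
  assumes subspace_D: "subspace (D n)"
    and d_in: "f \<in> D n \<Longrightarrow> d n f \<in> D (n + 1)"
    and d_add: "f \<in> D n \<Longrightarrow> g \<in> D n \<Longrightarrow> d n (f + g) = d n f + d n g"
    and d_scale: "f \<in> D n \<Longrightarrow> d n (scale c f) = scale c (d n f)"
    and d_d: "f \<in> D n \<Longrightarrow> d (n + 1) (d n f) = 0"

end

theory Submission
  imports Defs
begin

text \<open>
  Evaluated on words of letters, a cochain is a function \<open>F\<close> on words of length \<open>n\<close>. The two end
  terms of the coboundary, which use \<open>\<delta>\<close>, look different from the inner ones, which multiply two
  neighbours. The proof removes this difference: put
  \<open>augment F (c a\<^sub>1 \<dots> a\<^sub>n d) = \<delta>(c) F(a\<^sub>1 \<dots> a\<^sub>n) \<delta>(d)\<close>. As \<open>\<delta>\<close> is multiplicative, every term of the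
  coboundary becomes a merging of two adjacent letters in the longer word:
  \<open>augment (\<partial>F) w = (\<Sum>i\<le>n+1. (-1)^i augment F (merge i w))\<close> (lemma \<open>augment_word_coboundary\<close>; this is
  the bar complex with trivial coefficients). Since \<open>\<delta>(1) = 1\<close>, \<open>\<partial>F\<close> is recovered by padding
  a word with units on both sides. Each claim then reduces to a property of merging.

  \<^item> \<open>\<partial>\<partial> = 0\<close>: by associativity merging obeys the simplicial identity (\<open>merge_merge\<close>), so the terms
    of the double sum cancel in pairs (\<open>alternating_double_sum\<close>).
  \<^item> Normalization: merging a word of units gives a word of units.
  \<^item> Commuting with \<open>\<mu>\<^sup>(\<^sup>n\<^sup>)\<close>: because \<open>\<Delta>\<close> is multiplicative, Sweedler sums commute with merging, and
    merging does not change the product of a word (\<open>conv_merge\<close>). The counit identities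
    give \<open>(augment F \<star> \<mu>)(c a\<^sub>1 \<dots> a\<^sub>n d) = c (F \<star> \<mu>)(a\<^sub>1 \<dots> a\<^sub>n) d\<close>, and likewise for \<open>\<mu> \<star> F\<close>
    (\<open>conv_left_augment\<close>, \<open>conv_right_augment\<close>), so that commutation passes from \<open>F\<close> to \<open>\<partial>F\<close>.
  \<^item> Hermiticity: reversing a word and starring its letters exchanges the \<open>i\<close>-th and the
    \<open>(n+1-i)\<close>-th merging, whence \<open>\<partial>\<close> commutes with \<open>f \<mapsto> tilde f\<close> up to the factor \<open>(-1)^(n+1)\<close>
    (\<open>word_coboundary_star\<close>). This is the factor by which the sign in the definition of the
    hermitian cochains changes from \<open>n\<close> to \<open>n+1\<close> (\<open>hermitian_sign_Suc\<close>).
\<close>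

section \<open>Linear, bilinear and multilinear maps\<close>

abbreviation lin :: "('a::complex_vector \<Rightarrow> 'b::complex_vector) \<Rightarrow> bool" where
  "lin \<equiv> semilinear (\<lambda>c. c)"

lemma lin_iff_clinear: "lin g \<longleftrightarrow> clinear g"
  by (simp add: semilinear_def Vector_Spaces.linear_iff vector_space_scaleC)

lemma lin_id: "lin (\<lambda>x. x)"
  by (simp add: semilinear_def)

lemma lin_compose: "lin g \<Longrightarrow> lin h \<Longrightarrow> lin (\<lambda>x. g (h x))"
  by (simp add: semilinear_def)

lemma lin_mult:
  "lin g \<Longrightarrow> lin (\<lambda>x. b * g x)" "lin g \<Longrightarrow> lin (\<lambda>x. g x * b)"
  for b :: "'b::complex_algebra_1"
  by (simp_all add: semilinear_def scaleC_mult_left scaleC_mult_right algebra_simps)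

lemma lin_scaleC: "lin g \<Longrightarrow> lin (\<lambda>x. k *\<^sub>C g x)"
  by (simp add: semilinear_def scaleC_scaleC scaleC_add_right mult.commute)

lemma lin_scaleC_left: "lin g \<Longrightarrow> lin (\<lambda>x. g x *\<^sub>C v)"
  by (simp add: semilinear_def scaleC_scaleC scaleC_add_left scaleC_complex_def)

lemma lin_sum_list: "(\<And>i. i \<in> set xs \<Longrightarrow> lin (g i)) \<Longrightarrow> lin (\<lambda>x. \<Sum>i\<leftarrow>xs. g i x)"
  by (induction xs) (simp_all add: semilinear_def algebra_simps scaleC_add_right)

lemma lin_zero: "lin g \<Longrightarrow> g 0 = 0"
  unfolding semilinear_def by (metis scaleC_zero_left)

lemma lin_sum_list_apply: "lin g \<Longrightarrow> g (\<Sum>i\<leftarrow>xs. h i) = (\<Sum>i\<leftarrow>xs. g (h i))"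
  by (induction xs) (simp_all add: lin_zero, simp add: semilinear_def)

abbreviation multilinear :: "nat \<Rightarrow> ('a::complex_vector list \<Rightarrow> 'b::complex_vector) \<Rightarrow> bool" where
  "multilinear \<equiv> multi_semilinear (\<lambda>c. c)"

lemma lin_tlift: "multilinear n F \<Longrightarrow> lin (tlift n F)"
  by (rule semilinear_lift_along) auto

lemma tlift_pure: "multilinear n F \<Longrightarrow> tlift n F (pure w) = (if length w = n then F w else 0)"
  by (rule lift_along_pure) auto

lemma tlift_cong:
  assumes "\<And>w. length w = n \<Longrightarrow> F w = F' w"
  shows "lift_along \<sigma> n F = lift_along \<sigma> n F'"
  using assms unfolding lift_along_def by (intro arg_cong [where f = The] ext) auto

lemma tlift_eq_iff:
  assumes "multilinear n F" "multilinear n F'"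
  shows "tlift n F = tlift n F' \<longleftrightarrow> (\<forall>w. length w = n \<longrightarrow> F w = F' w)"
proof
  assume "tlift n F = tlift n F'"
  then have "tlift n F (pure w) = tlift n F' (pure w)" for w by simp
  then show "\<forall>w. length w = n \<longrightarrow> F w = F' w"
    using assms by (simp add: tlift_pure) metis
qed (auto intro: tlift_cong)

lemma multilinearD: "multilinear (length u + length v + 1) F \<Longrightarrow> lin (\<lambda>a. F (u @ a # v))"
  by (simp add: multi_semilinear_def)

lemma multilinear_compose: "multilinear n F \<Longrightarrow> lin T \<Longrightarrow> multilinear n (\<lambda>w. T (F w))"
  by (auto simp: multi_semilinear_def intro: lin_compose)

lemma multilinear_sum:
  "(\<And>i. i \<in> A \<Longrightarrow> multilinear n (F i)) \<Longrightarrow> multilinear n (\<lambda>w. \<Sum>i\<in>A. F i w)"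
  by (auto simp: multi_semilinear_def intro!: semilinear_sum)

lemma multilinear_cmult: "multilinear n F \<Longrightarrow> multilinear n (\<lambda>w. (k::complex) * F w)"
  by (auto simp: multi_semilinear_def intro!: semilinear_cmult)

lemma multilinear_pure: "clinear f \<Longrightarrow> multilinear n (\<lambda>w. f (pure w))"
  by (auto simp: multi_semilinear_def intro: semilinear_pure lin_id)

lemma multilinear_prod_list: "multilinear n (prod_list :: 'b::complex_algebra_1 list \<Rightarrow> 'b)"
  unfolding multi_semilinear_def
  by (auto simp flip: mult.assoc intro!: lin_mult lin_id)

lemma multilinear_pad:
  fixes F :: "'b::complex_vector list \<Rightarrow> 'v::complex_vector"
  assumes "multilinear (n + 2) F"
  shows "multilinear n (\<lambda>as. F (c # as @ [d]))"
  unfolding multi_semilinear_def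
proof (intro allI impI)
  fix u v :: "'b list"
  assume "length u + length v + 1 = n"
  then show "lin (\<lambda>a. F (c # (u @ a # v) @ [d]))"
    using multilinearD [of "c # u" "v @ [d]" F] assms by simp
qed

definition bilin :: "('a::complex_vector \<Rightarrow> 'b::complex_vector \<Rightarrow> 'c::complex_vector) \<Rightarrow> bool" where
  "bilin H \<longleftrightarrow> (\<forall>q. lin (\<lambda>p. H p q)) \<and> (\<forall>p. lin (H p))"

lemma bilin_lin:
  assumes "bilin H" "lin g"
  shows "lin (\<lambda>x. H (g x) q)" and "lin (\<lambda>x. H p (g x))"
  using assms lin_compose [of "\<lambda>x. H x q" g] lin_compose [of "H p" g] by (simp_all add: bilin_def)

lemma bilin_mult:
  fixes H :: "'b::complex_algebra_1 \<Rightarrow> 'b \<Rightarrow> 'v::complex_vector"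
  assumes "bilin H"
  shows "bilin (\<lambda>p' q'. H (p * p') (q * q'))"
  by (auto simp: bilin_def intro!: bilin_lin [OF assms] lin_mult lin_id)

lemma bilin_pure: "bilin (\<lambda>p q. pure [p, q])"
  by (simp add: bilin_def semilinear_def pure_add [of "[]", simplified] pure_scaleC [of "[]", simplified]
      pure_add [of "[_]" _ _ "[]", simplified] pure_scaleC [of "[_]" _ _ "[]", simplified])

lemma bilin_multilinear:
  assumes "bilin H"
  shows "multilinear 2 (\<lambda>u. H (u ! 0) (u ! 1))"
  unfolding multi_semilinear_def
proof (intro allI impI)
  fix u v :: "'a list"
  assume "length u + length v + 1 = 2"
  then consider b where "u = []" "v = [b]" | b where "u = [b]" "v = []"
    by (cases u; cases v) auto
  then show "lin (\<lambda>a. H ((u @ a # v) ! 0) ((u @ a # v) ! 1))"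
    using assms by cases (auto simp: bilin_def)
qed

text \<open>Multilinearity in the letters of two words at once is what Sweedler sums require.\<close>

definition bimultilinear ::
    "nat \<Rightarrow> ('b::complex_vector list \<Rightarrow> 'b list \<Rightarrow> 'v::complex_vector) \<Rightarrow> bool" where
  "bimultilinear n G \<longleftrightarrow>
    (\<forall>cs. length cs = n \<longrightarrow> multilinear n (\<lambda>bs. G bs cs)) \<and>
    (\<forall>bs. length bs = n \<longrightarrow> multilinear n (G bs))"

lemma bimultilinear_Cons:
  fixes G :: "'b::complex_vector list \<Rightarrow> 'b list \<Rightarrow> 'v::complex_vector"
  assumes "bimultilinear (Suc n) G"
  shows "bimultilinear n (\<lambda>bs cs. G (p # bs) (q # cs))"
  unfolding bimultilinear_def multi_semilinear_def
proof (intro conjI allI impI)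
  fix u v cs :: "'b list"
  assume "length cs = n" "length u + length v + 1 = n"
  with assms have "multilinear (Suc n) (\<lambda>bs. G bs (q # cs))" "length (p # u) + length v + 1 = Suc n"
    by (simp_all add: bimultilinear_def)
  then show "lin (\<lambda>a. G (p # u @ a # v) (q # cs))" unfolding multi_semilinear_def by fastforce
next
  fix bs u v :: "'b list"
  assume "length bs = n" "length u + length v + 1 = n"
  with assms have "multilinear (Suc n) (G (p # bs))" "length (q # u) + length v + 1 = Suc n"
    by (simp_all add: bimultilinear_def)
  then show "lin (\<lambda>a. G (p # bs) (q # u @ a # v))" unfolding multi_semilinear_def by fastforce
qed

lemma bimultilinear_bilin:
  assumes "bimultilinear (Suc n) G" "length bs = n" "length cs = n"
  shows "bilin (\<lambda>p q. G (p # bs) (q # cs))"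
  using assms multilinearD [of "[]" bs "\<lambda>bs. G bs (_ # cs)"] multilinearD [of "[]" cs "G (_ # bs)"]
  by (auto simp: bimultilinear_def bilin_def)

lemma bimultilinear_compose:
  "bimultilinear n G \<Longrightarrow> lin T \<Longrightarrow> bimultilinear n (\<lambda>bs cs. T (G bs cs))"
  by (auto simp: bimultilinear_def intro: multilinear_compose)

lemma bimultilinear_sum:
  "(\<And>i. i \<in> A \<Longrightarrow> bimultilinear n (G i)) \<Longrightarrow> bimultilinear n (\<lambda>bs cs. \<Sum>i\<in>A. G i bs cs)"
  by (auto simp: bimultilinear_def multi_semilinear_def intro!: semilinear_sum)

lemma bimultilinear_product:
  assumes "multilinear n F" "multilinear n P"
  shows "bimultilinear n (\<lambda>bs cs. F bs *\<^sub>C P cs)" and "bimultilinear n (\<lambda>bs cs. F cs *\<^sub>C P bs)"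
  using assms by (auto simp: bimultilinear_def multi_semilinear_def intro: lin_scaleC lin_scaleC_left)

section \<open>Cochains as functions on words\<close>

text \<open>Scalars are absorbed into the first factor.\<close>

lemma tpow2_sum_pure:
  assumes "x \<in> tpow 2"
  shows "\<exists>ps. x = (\<Sum>(p, q)\<leftarrow>ps. pure [p, q])"
proof -
  interpret vector_space "scaleC :: complex \<Rightarrow> 'a tens \<Rightarrow> 'a tens" by (rule vector_space_scaleC)
  from assms have "x \<in> span {pure w |w. length w = 2}" by (simp add: tpow_def)
  then show ?thesis
  proof (induction rule: span_induct_alt)
    case base
    show ?case by (rule exI [of _ "[]"]) simp
  next
    case (step c s y)
    then obtain ps a b where "y = (\<Sum>(p, q)\<leftarrow>ps. pure [p, q])" "s = pure [a, b]"
      by (auto simp: numeral_2_eq_2 length_Suc_conv)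
    then show ?case
      using pure_scaleC [of "[]" c a "[b]"] by (intro exI [of _ "(c *\<^sub>C a, b) # ps"]) simp
  qed
qed

lemma tpow_eq_0:
  assumes "clinear f" "\<And>w. length w = m \<Longrightarrow> f (pure w) = 0" "x \<in> tpow m"
  shows "f x = 0"
proof -
  interpret vector_space "scaleC :: complex \<Rightarrow> 'a tens \<Rightarrow> 'a tens" by (rule vector_space_scaleC)
  from assms(3) have "x \<in> span {pure w |w. length w = m}" by (simp add: tpow_def)
  then show ?thesis
    by (induction rule: span_induct_alt)
      (use assms(1,2) lin_zero [of f] in \<open>auto simp: lin_iff_clinear [symmetric] semilinear_def\<close>)
qed

lemma cochains_iff: "f \<in> cochains n \<longleftrightarrow> lin f \<and> (\<forall>w. length w \<noteq> n \<longrightarrow> f (pure w) = 0)"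
proof
  assume f: "f \<in> cochains n"
  interpret vector_space "scaleC :: complex \<Rightarrow> 'a tens \<Rightarrow> 'a tens" by (rule vector_space_scaleC)
  have "pure w \<in> tpow (length w)" for w :: "'a list"
    unfolding tpow_def by (rule span_base) auto
  with f show "lin f \<and> (\<forall>w. length w \<noteq> n \<longrightarrow> f (pure w) = 0)"
    by (auto simp: cochains_def lin_iff_clinear)
next
  assume f: "lin f \<and> (\<forall>w. length w \<noteq> n \<longrightarrow> f (pure w) = 0)"
  have "f x = 0" if "m \<noteq> n" "x \<in> tpow m" for m x
    by (rule tpow_eq_0 [OF _ _ that(2)]) (use f that(1) in \<open>auto simp: lin_iff_clinear\<close>)
  with f show "f \<in> cochains n"
    by (auto simp: cochains_def lin_iff_clinear)
qed

lemma cochains_eqI: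
  assumes "f \<in> cochains n" "g \<in> cochains n" "\<And>w. length w = n \<Longrightarrow> f (pure w) = g (pure w)"
  shows "f = g"
  by (rule semilinear_unique [of "\<lambda>c. c"]) (use assms in \<open>auto simp: cochains_iff, metis\<close>)

lemma tlift_cochain: "multilinear n F \<Longrightarrow> tlift n F \<in> cochains n"
  by (simp add: cochains_iff lin_tlift tlift_pure)

lemma multilinear_cochain: "f \<in> cochains n \<Longrightarrow> multilinear m (\<lambda>w. f (pure w))"
  by (intro multilinear_pure) (simp add: cochains_def)

lemma cochains_zero: "0 \<in> cochains n"
  and cochains_add: "f \<in> cochains n \<Longrightarrow> g \<in> cochains n \<Longrightarrow> f + g \<in> cochains n"
  and cochains_scaleC: "f \<in> cochains n \<Longrightarrow> c *\<^sub>C f \<in> cochains n"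
  by (auto simp: cochains_iff semilinear_def plus_fun_def scaleC_fun_def scaleC_complex_def algebra_simps)

section \<open>Merging adjacent letters\<close>

text \<open>The face maps of the bar complex.\<close>

fun merge :: "nat \<Rightarrow> 'b::times list \<Rightarrow> 'b list" where
  "merge 0 (a # b # w) = a * b # w"
| "merge (Suc i) (a # w) = a # merge i w"
| "merge _ w = w"

lemma length_merge: "Suc i < length w \<Longrightarrow> length (merge i w) = length w - 1"
  by (induction i w rule: merge.induct) auto

lemma merge_take_drop:
  "Suc i < length w \<Longrightarrow> merge i w = take i w @ (w ! i * w ! Suc i) # drop (i + 2) w"
  by (induction i w rule: merge.induct) auto

lemma merge_append_left: "merge (length u + i) (u @ w) = u @ merge i w"
  by (induction u) auto

lemma merge_append_right: "Suc i < length u \<Longrightarrow> merge i (u @ w) = merge i u @ w"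
  by (induction i u rule: merge.induct) auto

lemma prod_list_merge: "prod_list (merge i w) = prod_list (w :: 'b::monoid_mult list)"
  by (induction i w rule: merge.induct) (auto simp: mult.assoc)

lemma merge_replicate:
  "Suc i < n \<Longrightarrow> merge i (replicate n (1 :: 'b::monoid_mult)) = replicate (n - 1) 1"
proof (induction i arbitrary: n)
  case 0
  then obtain m where "n = Suc (Suc m)" by (cases n; cases "n - 1") auto
  then show ?case by simp
next
  case (Suc i)
  then obtain m where "n = Suc m" "Suc i < m" by (cases n) auto
  moreover from this obtain k where "m = Suc k" by (cases m) auto
  ultimately show ?case using Suc.IH [of m] by simp
qed

text \<open>
  The simplicial identity. For \<open>i < k\<close> the mergings happen at disjoint places; for \<open>i = k\<close> both
  sides multiply the same three letters, and associativity is needed.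
\<close>

lemma merge_merge:
  fixes w :: "'b::semigroup_mult list"
  assumes "i \<le> k" "k + 2 < length w"
  shows "merge i (merge (Suc k) w) = merge k (merge i w)"
  using assms
proof (induction i w arbitrary: k rule: merge.induct)
  case (1 a b w)
  then show ?case by (cases k; cases w) (auto simp: mult.assoc)
next
  case (2 i a w)
  then show ?case by (cases k) auto
qed auto

lemma merge_map_rev:
  fixes s :: "'b::times \<Rightarrow> 'b"
  assumes s: "\<And>a b. s (a * b) = s b * s a" and "i + j + 2 = length w"
  shows "merge i (map s (rev w)) = map s (rev (merge j w))"
  using assms(2)
proof (induction j w rule: merge.induct)
  case (1 a b w)
  then show ?case
    using merge_append_left [of "map s (rev w)" 0 "[s b, s a]"] by (simp add: s)
next
  case (2 j a w)
  then show ?case using merge_append_right [of i "map s (rev w)" "[s a]"] by simp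
qed auto

text \<open>
  Seen as a function of one letter, a merged word still has a single varying letter, which is
  the original one, possibly multiplied by a neighbour from the left or from the right.
\<close>

lemma merge_slot:
  fixes u v :: "'b::complex_algebra_1 list"
  assumes "i + 1 < length u + length v + 1"
  shows "\<exists>u' v' h. lin h \<and> length u' + length v' + 1 = length u + length v
    \<and> (\<forall>a. merge i (u @ a # v) = u' @ h a # v')"
proof -
  consider "i + 1 < length u" | "i + 1 = length u" | "length u \<le> i" by linarith
  then show ?thesis
  proof cases
    case 1
    then show ?thesis
      by (intro exI [of _ "merge i u"] exI [of _ v] exI [of _ "\<lambda>a. a"])
        (simp add: merge_append_right length_merge lin_id)
  next
    case 2
    then obtain u' b where u: "u = u' @ [b]" "i = length u'"
      by (cases u rule: rev_cases) auto
    show ?thesis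
      by (intro exI [of _ u'] exI [of _ v] exI [of _ "\<lambda>a. b * a"])
        (use merge_append_left [of u' 0] in \<open>simp add: u lin_id lin_mult\<close>)
  next
    case 3
    then obtain j where j: "i = length u + j" using le_Suc_ex by blast
    obtain b v' where v: "v = b # v'" using assms 3 by (cases v) auto
    show ?thesis
    proof (cases j)
      case 0
      show ?thesis
        by (intro exI [of _ u] exI [of _ v'] exI [of _ "\<lambda>a. a * b"])
          (simp add: j 0 v merge_append_left [of _ 0, simplified] lin_id lin_mult)
    next
      case (Suc k)
      have e: "merge i (u @ a # v) = u @ a # merge k v" for a
        using merge_append_left [of u "Suc k" "a # v"] by (simp add: j Suc)
      have "length (merge k v) + 1 = length v"
        using assms by (simp add: j Suc length_merge)
      then show ?thesis
        by (intro exI [of _ u] exI [of _ "merge k v"] exI [of _ "\<lambda>a. a"])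
          (simp add: e lin_id)
    qed
  qed
qed

lemma multilinear_merge:
  fixes F :: "'b::complex_algebra_1 list \<Rightarrow> 'c::complex_vector"
  assumes "multilinear n F" "i < n"
  shows "multilinear (Suc n) (\<lambda>w. F (merge i w))"
  unfolding multi_semilinear_def
proof (intro allI impI)
  fix u v :: "'b list"
  assume len: "length u + length v + 1 = Suc n"
  then obtain u' v' h where h: "lin h" "length u' + length v' + 1 = n"
    "\<And>a. merge i (u @ a # v) = u' @ h a # v'"
    using merge_slot [of i u v] assms(2) by auto
  with assms(1) have "lin (\<lambda>a. F (u' @ a # v'))" by (auto simp: multi_semilinear_def)
  then show "lin (\<lambda>a. F (merge i (u @ a # v)))" unfolding h(3) by (rule lin_compose) (rule h(1))
qed

text \<open>
  The cancellation behind \<open>\<partial>\<partial> = 0\<close> for any face maps: \<open>h i j\<close> stands for the value after applying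
  the \<open>j\<close>-th and then the \<open>i\<close>-th face, and the assumption is the simplicial identity. The two
  equal values have opposite signs.
\<close>

lemma alternating_double_sum:
  fixes h :: "nat \<Rightarrow> nat \<Rightarrow> 'r::comm_ring_1"
  assumes "\<And>i k. i \<le> k \<Longrightarrow> k \<le> m \<Longrightarrow> h i (Suc k) = h k i"
  shows "(\<Sum>j\<le>Suc m. \<Sum>i\<le>m. (- 1) ^ (i + j) * h i j) = 0"
  using assms
proof (induction m)
  case 0
  then show ?case by simp
next
  case (Suc m)
  (* Enlarging the range adds one row and one column of the array, and these cancel. *)
  define t where "t i j = (- 1) ^ (i + j) * h i j" for i j
  have "(\<Sum>i\<le>Suc m. t i (Suc (Suc m))) = - (\<Sum>j\<le>Suc m. t (Suc m) j)"
    unfolding sum_negf [symmetric] using Suc.prems by (intro sum.cong) (simp_all add: t_def add.commute)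
  moreover have "(\<Sum>j\<le>Suc m. \<Sum>i\<le>m. t i j) = 0" using Suc by (simp add: t_def)
  moreover have "(\<Sum>j\<le>Suc (Suc m). \<Sum>i\<le>Suc m. t i j) =
      (\<Sum>j\<le>Suc m. (\<Sum>i\<le>m. t i j) + t (Suc m) j) + (\<Sum>i\<le>Suc m. t i (Suc (Suc m)))"
    by (simp only: sum.atMost_Suc)
  ultimately have "(\<Sum>j\<le>Suc (Suc m). \<Sum>i\<le>Suc m. t i j) = 0"
    by (simp only: sum.distrib) simp
  then show ?case by (simp only: t_def)
qed

section \<open>Sweedler sums\<close>

lemma sweedler_cong:
  assumes "\<And>bs cs. length bs = length as \<Longrightarrow> length cs = length as \<Longrightarrow> G bs cs = G' bs cs"
  shows "sweedler \<Delta> as G = sweedler \<Delta> as G'"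
  using assms
proof (induction as arbitrary: G G')
  case (Cons a as)
  have "sweedler \<Delta> as (\<lambda>bs cs. G (p # bs) (q # cs)) = sweedler \<Delta> as (\<lambda>bs cs. G' (p # bs) (q # cs))"
    for p q by (rule Cons.IH) (simp add: Cons.prems)
  then show ?case by simp
qed simp

lemma sum_list_concat_map: "(\<Sum>x\<leftarrow>concat (map f xs). g x) = (\<Sum>y\<leftarrow>xs. \<Sum>x\<leftarrow>f y. g x)"
  by (induction xs) simp_all

context bialgebra
begin

text \<open>
  A chosen representation of \<open>\<Delta> a\<close> as a sum of elementary tensors turns Sweedler sums of multilinear
  functions into ordinary finite sums (\<open>sweedler_legs\<close>), for which linearity properties are evident.
\<close>

definition legs :: "'b \<Rightarrow> ('b \<times> 'b) list" where
  "legs a = (SOME ps. \<Delta> a = (\<Sum>(p, q)\<leftarrow>ps. pure [p, q]))"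

lemma comult_legs: "\<Delta> a = (\<Sum>(p, q)\<leftarrow>legs a. pure [p, q])"
  unfolding legs_def by (rule someI_ex) (rule tpow2_sum_pure [OF comult_range])

text \<open>One layer of the recursion that defines \<open>sweedler\<close>.\<close>

definition sweedler1 :: "('b \<Rightarrow> 'b \<Rightarrow> 'v::complex_vector) \<Rightarrow> 'b \<Rightarrow> 'v" where
  "sweedler1 H a = tlift 2 (\<lambda>u. H (u ! 0) (u ! 1)) (\<Delta> a)"

lemma sweedler_Cons:
  "sweedler \<Delta> (a # as) G = sweedler1 (\<lambda>p q. sweedler \<Delta> as (\<lambda>bs cs. G (p # bs) (q # cs))) a"
  by (simp add: sweedler1_def)

lemma tlift2_sum_pure:
  assumes "bilin H"
  shows "tlift 2 (\<lambda>u. H (u ! 0) (u ! 1)) (\<Sum>(p, q)\<leftarrow>ps. pure [p, q]) = (\<Sum>(p, q)\<leftarrow>ps. H p q)"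
  using bilin_multilinear [OF assms]
  by (simp add: lin_sum_list_apply lin_tlift split_def tlift_pure)

lemma sweedler1_legs: "bilin H \<Longrightarrow> sweedler1 H a = (\<Sum>(p, q)\<leftarrow>legs a. H p q)"
  unfolding sweedler1_def by (subst comult_legs) (rule tlift2_sum_pure)

lemma lin_sweedler1: "bilin H \<Longrightarrow> lin (sweedler1 H)"
  unfolding sweedler1_def
  by (intro lin_compose [of "tlift 2 _" \<Delta>] lin_tlift bilin_multilinear semilinear_clinear comult_linear)

lemma sweedler1_lin:
  assumes "bilin H" "lin T"
  shows "sweedler1 (\<lambda>p q. T (H p q)) a = T (sweedler1 H a)"
proof -
  have "bilin (\<lambda>p q. T (H p q))" using assms by (auto simp: bilin_def intro: lin_compose)
  then show ?thesis
    by (simp add: sweedler1_legs assms lin_sum_list_apply split_def)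
qed

lemma bilin_sweedler1_mult:
  assumes "bilin H"
  shows "bilin (\<lambda>p q. sweedler1 (\<lambda>p' q'. H (p * p') (q * q')) b)"
  unfolding sweedler1_legs [OF bilin_mult [OF assms]] split_def
  by (auto simp: bilin_def intro!: lin_sum_list bilin_lin [OF assms] lin_mult lin_id)

text \<open>
  Multiplicativity of \<open>\<Delta>\<close>. The chosen representation of \<open>\<Delta> (a * b)\<close> is unrelated to those of \<open>\<Delta> a\<close> and
  \<open>\<Delta> b\<close>, but the value on a bilinear \<open>H\<close> depends only on the tensor.
\<close>

lemma sweedler1_mult:
  assumes "bilin H"
  shows "sweedler1 H (a * b) = sweedler1 (\<lambda>p q. sweedler1 (\<lambda>p' q'. H (p * p') (q * q')) b) a"
proof -
  note expand = sweedler1_legs [OF bilin_sweedler1_mult] sweedler1_legs [OF bilin_mult]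
  have "\<Delta> (a * b) = sweedler1 (\<lambda>p q. sweedler1 (\<lambda>p' q'. pure [p * p', q * q']) b) a"
    by (simp add: comult_mult tmult2_def sweedler1_def)
  also have "\<dots> = (\<Sum>(p, q)\<leftarrow>legs a. \<Sum>(p', q')\<leftarrow>legs b. pure [p * p', q * q'])"
    unfolding expand(1) [OF bilin_pure] unfolding expand(2) [OF bilin_pure] ..
  finally have "sweedler1 H (a * b) = (\<Sum>(p, q)\<leftarrow>legs a. \<Sum>(p', q')\<leftarrow>legs b. H (p * p') (q * q'))"
    using bilin_multilinear [OF assms] unfolding sweedler1_def
    by (simp add: lin_sum_list_apply lin_tlift split_def tlift_pure)
  then show ?thesis
    unfolding expand(1) [OF assms] unfolding expand(2) [OF assms] .
qed

lemma sweedler1_counit_left: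
  assumes "lin T" shows "sweedler1 (\<lambda>p q. \<delta> p *\<^sub>C T q) a = T a"
proof -
  have b: "bilin (\<lambda>p q. \<delta> p *\<^sub>C q)"
    using semilinear_clinear [OF counit_linear]
    by (simp add: bilin_def lin_scaleC lin_scaleC_left lin_id)
  have "sweedler1 (\<lambda>p q. \<delta> p *\<^sub>C T q) a = sweedler1 (\<lambda>p q. T (\<delta> p *\<^sub>C q)) a"
    using assms by (simp add: semilinear_def)
  also have "\<dots> = T a"
    by (simp only: sweedler1_lin [OF b assms]) (simp add: sweedler1_def counit_left del: One_nat_def)
  finally show ?thesis .
qed

lemma sweedler1_counit_right:
  assumes "lin T" shows "sweedler1 (\<lambda>p q. \<delta> q *\<^sub>C T p) a = T a"
proof -
  have b: "bilin (\<lambda>p q. \<delta> q *\<^sub>C p)"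
    using semilinear_clinear [OF counit_linear]
    by (simp add: bilin_def lin_scaleC lin_scaleC_left lin_id)
  have "sweedler1 (\<lambda>p q. \<delta> q *\<^sub>C T p) a = sweedler1 (\<lambda>p q. T (\<delta> q *\<^sub>C p)) a"
    using assms by (simp add: semilinear_def)
  also have "\<dots> = T a"
    by (simp only: sweedler1_lin [OF b assms]) (simp add: sweedler1_def counit_right del: One_nat_def)
  finally show ?thesis .
qed

lemma sweedler_legs:
  assumes "bimultilinear (length as) G"
  shows "sweedler \<Delta> as G = (\<Sum>ps\<leftarrow>product_lists (map legs as). G (map fst ps) (map snd ps))"
  using assms
proof (induction as arbitrary: G)
  case (Cons a as)
  then have G: "bimultilinear (Suc (length as)) G" by simp
  have IH: "sweedler \<Delta> as (\<lambda>bs cs. G (p # bs) (q # cs)) =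
      (\<Sum>ps\<leftarrow>product_lists (map legs as). G (p # map fst ps) (q # map snd ps))" for p q
    by (rule Cons.IH) (rule bimultilinear_Cons [OF G])
  have "bilin (\<lambda>p q. \<Sum>ps\<leftarrow>product_lists (map legs as). G (p # map fst ps) (q # map snd ps))"
    using bimultilinear_bilin [OF G]
    by (auto simp: bilin_def dest: in_set_product_lists_length intro!: lin_sum_list)
  then show ?case
    unfolding sweedler_Cons IH
    by (simp add: sweedler1_legs sum_list_concat_map comp_def split_def)
qed simp

lemma bilin_sweedler:
  assumes "bimultilinear (Suc (length as)) G"
  shows "bilin (\<lambda>p q. sweedler \<Delta> as (\<lambda>bs cs. G (p # bs) (q # cs)))"
  using bimultilinear_bilin [OF assms]
  by (auto simp: sweedler_legs [OF bimultilinear_Cons [OF assms]] bilin_def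
    dest: in_set_product_lists_length intro!: lin_sum_list)

lemma sweedler_lin:
  assumes "bimultilinear (length as) G" "lin T"
  shows "sweedler \<Delta> as (\<lambda>bs cs. T (G bs cs)) = T (sweedler \<Delta> as G)"
  using assms by (simp add: sweedler_legs bimultilinear_compose lin_sum_list_apply)

lemma sweedler_sum:
  assumes "\<And>i. i \<in> A \<Longrightarrow> bimultilinear (length as) (G i)"
  shows "sweedler \<Delta> as (\<lambda>bs cs. \<Sum>i\<in>A. G i bs cs) = (\<Sum>i\<in>A. sweedler \<Delta> as (G i))"
proof -
  have "(\<Sum>x\<leftarrow>xs. \<Sum>i\<in>A. g i x) = (\<Sum>i\<in>A. \<Sum>x\<leftarrow>xs. g i x)" for xs :: "'x list" and g :: "_ \<Rightarrow> 'x \<Rightarrow> 'v::complex_vector"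
    by (induction xs) (simp_all add: sum.distrib)
  then show ?thesis
    using assms by (simp add: sweedler_legs bimultilinear_sum)
qed

lemma multilinear_sweedler:
  assumes "bimultilinear n G"
  shows "multilinear n (\<lambda>as. sweedler \<Delta> as G)"
  unfolding multi_semilinear_def
proof (intro allI impI)
  fix u v :: "'b list"
  assume "length u + length v + 1 = n"
  with assms show "lin (\<lambda>a. sweedler \<Delta> (u @ a # v) G)"
  proof (induction u arbitrary: n G)
    case Nil
    then show ?case
      using lin_sweedler1 [OF bilin_sweedler [of v G]] by (simp add: sweedler_Cons del: sweedler.simps)
  next
    case (Cons x u)
    then obtain m where m: "n = Suc m" "length u + length v + 1 = m" by (cases n) auto
    from Cons.prems have "bimultilinear m (\<lambda>bs cs. G (p # bs) (q # cs))" for p q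
      unfolding m by (intro bimultilinear_Cons)
    then have "lin (\<lambda>a. sweedler \<Delta> (u @ a # v) (\<lambda>bs cs. G (p # bs) (q # cs)))" for p q
      using Cons.IH m(2) by blast
    moreover have "sweedler \<Delta> (x # u @ a # v) G =
        (\<Sum>(p, q)\<leftarrow>legs x. sweedler \<Delta> (u @ a # v) (\<lambda>bs cs. G (p # bs) (q # cs)))" for a
      unfolding sweedler_Cons using Cons.prems m
      by (intro sweedler1_legs bilin_sweedler) simp
    ultimately show ?case
      by (simp add: lin_sum_list split_def del: sweedler.simps)
  qed
qed

text \<open>
  At the place of the merging this is multiplicativity of \<open>\<Delta>\<close>; the letters before it are
  peeled off by the recursion of \<open>sweedler\<close>.
\<close>

lemma sweedler_merge:
  assumes "bimultilinear n G" "length w = Suc n" "i < n"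
  shows "sweedler \<Delta> (merge i w) G = sweedler \<Delta> w (\<lambda>bs cs. G (merge i bs) (merge i cs))"
  using assms
proof (induction i w arbitrary: n G rule: merge.induct)
  case (1 a b w)
  then have "bimultilinear (Suc (length w)) G" by simp
  from sweedler1_mult [OF bilin_sweedler [OF this]] show ?case
    by (simp add: sweedler_Cons del: sweedler.simps)
next
  case (2 i a w)
  then obtain m where m: "n = Suc m" by (cases n) auto
  have "sweedler \<Delta> (merge i w) (\<lambda>bs cs. G (p # bs) (q # cs)) =
      sweedler \<Delta> w (\<lambda>bs cs. G (p # merge i bs) (q # merge i cs))" for p q
    using 2 m by (intro "2.IH" [of m] bimultilinear_Cons) auto
  then show ?case by (simp add: sweedler_Cons del: sweedler.simps)
qed auto

text \<open>The last letter is innermost in the recursion of \<open>sweedler\<close>; bringing it out lets a counit identity act on it.\<close>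

lemma sweedler_snoc:
  "sweedler \<Delta> (as @ [a]) G = sweedler \<Delta> as (\<lambda>bs cs. sweedler1 (\<lambda>p q. G (bs @ [p]) (cs @ [q])) a)"
  by (induction as arbitrary: G) (simp_all add: sweedler1_def)

section \<open>Convolution with the multiplication\<close>

text \<open>\<open>F \<star> \<mu>\<^sup>(\<^sup>n\<^sup>)\<close> and \<open>\<mu>\<^sup>(\<^sup>n\<^sup>) \<star> F\<close>, as functions on words of length \<open>n\<close>.\<close>

definition conv_left :: "('b list \<Rightarrow> complex) \<Rightarrow> 'b list \<Rightarrow> 'b" where
  "conv_left F as = sweedler \<Delta> as (\<lambda>bs cs. F bs *\<^sub>C prod_list cs)"

definition conv_right :: "('b list \<Rightarrow> complex) \<Rightarrow> 'b list \<Rightarrow> 'b" where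
  "conv_right F as = sweedler \<Delta> as (\<lambda>bs cs. F cs *\<^sub>C prod_list bs)"

lemma conv_cong:
  assumes "\<And>w. length w = length as \<Longrightarrow> F w = F' w"
  shows "conv_left F as = conv_left F' as" "conv_right F as = conv_right F' as"
  unfolding conv_left_def conv_right_def using assms by (auto intro!: sweedler_cong)

lemma multilinear_conv:
  assumes "multilinear n F"
  shows "multilinear n (conv_left F)" "multilinear n (conv_right F)"
  unfolding conv_left_def conv_right_def
  by (intro multilinear_sweedler bimultilinear_product assms multilinear_prod_list)+

lemma conv_lincomb:
  assumes "\<And>i. i \<in> A \<Longrightarrow> multilinear (length as) (F i)"
  shows "conv_left (\<lambda>w. \<Sum>i\<in>A. k i * F i w) as = (\<Sum>i\<in>A. k i *\<^sub>C conv_left (F i) as)"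
    and "conv_right (\<lambda>w. \<Sum>i\<in>A. k i * F i w) as = (\<Sum>i\<in>A. k i *\<^sub>C conv_right (F i) as)"
proof -
  have distrib: "(\<Sum>i\<in>A. k i * g i) *\<^sub>C v = (\<Sum>i\<in>A. k i *\<^sub>C g i *\<^sub>C v)" for g and v :: 'b
    by (induction A rule: infinite_finite_induct) (simp_all add: scaleC_add_left scaleC_scaleC)
  have lin: "lin (\<lambda>v::'b. k i *\<^sub>C v)" for i by (intro lin_scaleC lin_id)
  note G = bimultilinear_product [OF assms multilinear_prod_list]
  show "conv_left (\<lambda>w. \<Sum>i\<in>A. k i * F i w) as = (\<Sum>i\<in>A. k i *\<^sub>C conv_left (F i) as)"
    unfolding conv_left_def distrib
    by (subst sweedler_sum) (simp_all add: bimultilinear_compose [OF G(1) lin] sweedler_lin [OF G(1) lin])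
  show "conv_right (\<lambda>w. \<Sum>i\<in>A. k i * F i w) as = (\<Sum>i\<in>A. k i *\<^sub>C conv_right (F i) as)"
    unfolding conv_right_def distrib
    by (subst sweedler_sum) (simp_all add: bimultilinear_compose [OF G(2) lin] sweedler_lin [OF G(2) lin])
qed

lemma conv_add:
  assumes "multilinear (length as) F" "multilinear (length as) F'"
  shows "conv_left (\<lambda>w. F w + F' w) as = conv_left F as + conv_left F' as"
    and "conv_right (\<lambda>w. F w + F' w) as = conv_right F as + conv_right F' as"
  using conv_lincomb [of "UNIV :: bool set" as "\<lambda>b. if b then F else F'" "\<lambda>_. 1"] assms
  by (simp_all add: UNIV_bool scaleC_one add.commute)

lemma conv_cmult:
  assumes "multilinear (length as) F"
  shows "conv_left (\<lambda>w. k * F w) as = k *\<^sub>C conv_left F as"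
    and "conv_right (\<lambda>w. k * F w) as = k *\<^sub>C conv_right F as"
  using conv_lincomb [of "{()}" as "\<lambda>_. F" "\<lambda>_. k"] assms by simp_all

text \<open>
  Combines the compatibility of \<open>sweedler\<close> with merging and the fact that merging preserves the product
  of the other Sweedler factors.
\<close>

lemma conv_merge:
  assumes "multilinear n F" "length w = Suc n" "i < n"
  shows "conv_left (\<lambda>v. F (merge i v)) w = conv_left F (merge i w)"
    and "conv_right (\<lambda>v. F (merge i v)) w = conv_right F (merge i w)"
  using sweedler_merge [OF bimultilinear_product(1) [OF assms(1) multilinear_prod_list] assms(2,3)]
    sweedler_merge [OF bimultilinear_product(2) [OF assms(1) multilinear_prod_list] assms(2,3)]
  by (simp_all add: conv_left_def conv_right_def prod_list_merge)

lemma cochains_C_iff: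
  assumes "f \<in> cochains n"
  shows "f \<in> cochains_C \<Delta> n \<longleftrightarrow>
    (\<forall>as. length as = n \<longrightarrow> conv_left (\<lambda>w. f (pure w)) as = conv_right (\<lambda>w. f (pure w)) as)"
proof -
  have mu: "mu n (pure cs) = prod_list cs" if "length cs = n" for cs :: "'b list"
    using that by (simp add: mu_def tlift_pure multilinear_prod_list)
  have "conv_mu \<Delta> n f = tlift n (conv_left (\<lambda>w. f (pure w)))"
    unfolding conv_mu_def conv_left_def by (intro tlift_cong sweedler_cong) (simp add: mu)
  moreover have "mu_conv \<Delta> n f = tlift n (conv_right (\<lambda>w. f (pure w)))"
    unfolding mu_conv_def conv_right_def by (intro tlift_cong sweedler_cong) (simp add: mu)
  ultimately show ?thesis
    using assms by (simp add: cochains_C_def tlift_eq_iff multilinear_conv multilinear_cochain)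
qed

section \<open>The coboundary in terms of merging\<close>

definition augment :: "('b list \<Rightarrow> complex) \<Rightarrow> 'b list \<Rightarrow> complex" where
  "augment F w = \<delta> (hd w) * F (butlast (tl w)) * \<delta> (last w)"

lemma augment_pad [simp]: "augment F (c # as @ [d]) = \<delta> c * F as * \<delta> d"
  by (simp add: augment_def)

lemma augment_cong:
  assumes "\<And>v. length v = n \<Longrightarrow> F v = F' v" "length w = n + 2"
  shows "augment F w = augment F' w"
  using assms by (simp add: augment_def)

lemma augment_add: "augment (\<lambda>w. F w + F' w) w = augment F w + augment F' w"
  and augment_cmult: "augment (\<lambda>w. c * F w) w = c * augment F w"
  by (simp_all add: augment_def algebra_simps)

lemma word_cases:
  assumes "length w = n + 2"
  obtains c as d where "w = c # as @ [d]" "length as = n"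
proof -
  obtain c w' where "w = c # w'" using assms by (cases w) auto
  moreover obtain as d where "w' = as @ [d]" using assms calculation by (cases w' rule: rev_cases) auto
  ultimately show ?thesis using assms that by simp
qed

lemma lin_counit: "lin \<delta>"
  by (rule semilinear_clinear) (rule counit_linear)

lemma multilinear_augment:
  assumes F: "multilinear n F"
  shows "multilinear (n + 2) (augment F)"
  unfolding multi_semilinear_def
proof (intro allI impI)
  fix u v :: "'b list"
  assume len: "length u + length v + 1 = n + 2"
  show "lin (\<lambda>a. augment F (u @ a # v))"
  proof (cases u)
    case Nil
    with len obtain as d where v: "v = as @ [d]" by (cases v rule: rev_cases) auto
    show ?thesis by (simp add: Nil v semilinear_cmult_right lin_counit)
  next
    case (Cons c u')
    show ?thesis
    proof (cases v rule: rev_cases)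
      case Nil
      show ?thesis by (simp add: Cons Nil semilinear_cmult lin_counit)
    next
      case (snoc v' d)
      have "lin (\<lambda>a. F (u' @ a # v'))"
        by (rule multilinearD) (use F len in \<open>simp add: Cons snoc\<close>)
      moreover have "augment F (u @ a # v) = \<delta> c * F (u' @ a # v') * \<delta> d" for a
        using augment_pad [of F c "u' @ a # v'" d] by (simp add: Cons snoc)
      ultimately show ?thesis by (simp add: semilinear_cmult semilinear_cmult_right)
    qed
  qed
qed

text \<open>
  In the first and in the last Sweedler factor the value of \<open>\<delta>\<close> meets the complementary leg, and the
  counit identities collapse that pair to the letter itself. The first letter can leave the sum to the left
  and the last one to the right, since they are the outer factors of the product.
\<close>

lemma conv_left_augment:
  assumes "multilinear (length as) F"
  shows "conv_left (augment F) (c # as @ [d]) = c * conv_left F as * d"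
proof -
  have last: "sweedler1 (\<lambda>p q. (\<delta> x * F bs * \<delta> p) *\<^sub>C (y * (prod_list cs * q))) d
      = \<delta> x *\<^sub>C y * (F bs *\<^sub>C prod_list cs) * d" for x y bs cs
  proof -
    have "lin (\<lambda>q. \<delta> x *\<^sub>C y * (F bs *\<^sub>C prod_list cs) * q)"
      by (intro lin_mult lin_id)
    from sweedler1_counit_left [OF this, of d] show ?thesis
      by (simp add: scaleC_mult_left scaleC_mult_right scaleC_scaleC mult_ac)
  qed
  have middle: "sweedler \<Delta> as (\<lambda>bs cs. \<delta> x *\<^sub>C y * (F bs *\<^sub>C prod_list cs) * d)
      = \<delta> x *\<^sub>C (y * conv_left F as * d)" for x y
  proof -
    have "lin (\<lambda>v. \<delta> x *\<^sub>C y * v * d)" by (intro lin_mult lin_id)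
    from sweedler_lin [OF bimultilinear_product(1) [OF assms multilinear_prod_list] this] show ?thesis
      by (simp add: conv_left_def scaleC_mult_left)
  qed
  show ?thesis
    using sweedler1_counit_left [of "\<lambda>y. y * conv_left F as * d" c]
    by (simp add: conv_left_def [of "augment F"] sweedler_Cons sweedler_snoc last middle lin_mult lin_id
      del: sweedler.simps)
qed

lemma conv_right_augment:
  assumes "multilinear (length as) F"
  shows "conv_right (augment F) (c # as @ [d]) = c * conv_right F as * d"
proof -
  have last: "sweedler1 (\<lambda>p q. (\<delta> x * F cs * \<delta> q) *\<^sub>C (y * (prod_list bs * p))) d
      = \<delta> x *\<^sub>C y * (F cs *\<^sub>C prod_list bs) * d" for x y bs cs
  proof -
    have "lin (\<lambda>q. \<delta> x *\<^sub>C y * (F cs *\<^sub>C prod_list bs) * q)"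
      by (intro lin_mult lin_id)
    from sweedler1_counit_right [OF this, of d] show ?thesis
      by (simp add: scaleC_mult_left scaleC_mult_right scaleC_scaleC mult_ac)
  qed
  have middle: "sweedler \<Delta> as (\<lambda>bs cs. \<delta> x *\<^sub>C y * (F cs *\<^sub>C prod_list bs) * d)
      = \<delta> x *\<^sub>C (y * conv_right F as * d)" for x y
  proof -
    have "lin (\<lambda>v. \<delta> x *\<^sub>C y * v * d)" by (intro lin_mult lin_id)
    from sweedler_lin [OF bimultilinear_product(2) [OF assms multilinear_prod_list] this] show ?thesis
      by (simp add: conv_right_def scaleC_mult_left)
  qed
  show ?thesis
    using sweedler1_counit_right [of "\<lambda>y. y * conv_right F as * d" c]
    by (simp add: conv_right_def [of "augment F"] sweedler_Cons sweedler_snoc last middle lin_mult lin_id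
      del: sweedler.simps)
qed

definition word_coboundary :: "nat \<Rightarrow> ('b list \<Rightarrow> complex) \<Rightarrow> 'b list \<Rightarrow> complex" where
  "word_coboundary n F as = (\<Sum>i\<le>n + 1. (- 1) ^ i * augment F (merge i (1 # as @ [1])))"

text \<open>
  The inner faces do not touch the padding letters \<open>c\<close> and \<open>d\<close>. The outer faces give \<open>\<delta>(c a\<^sub>1)\<close> and
  \<open>\<delta>(a\<^sub>n\<^sub>+\<^sub>1 d)\<close>, which split because \<open>\<delta>\<close> is multiplicative; this produces the end terms of the
  coboundary formula.
\<close>

lemma sum_augment_merge:
  assumes len: "length as = n + 1"
  shows "(\<Sum>i\<le>n + 1. (- 1) ^ i * augment F (merge i (c # as @ [d]))) =
    \<delta> c * (\<delta> (hd as) * F (tl as)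
      + (\<Sum>i = 1..n. (- 1) ^ i * F (take (i - 1) as @ (as ! (i - 1) * as ! i) # drop (i + 1) as))
      + (- 1) ^ (n + 1) * F (butlast as) * \<delta> (last as)) * \<delta> d"
proof -
  let ?t = "\<lambda>i. (- 1) ^ i * augment F (merge i (c # as @ [d]))"
  have "{..n + 1} = insert 0 (insert (n + 1) {1..n})" by auto
  then have split: "(\<Sum>i\<le>n + 1. ?t i) = ?t 0 + (\<Sum>i = 1..n. ?t i) + ?t (n + 1)" by simp
  (* The two outer faces absorb a padding letter; multiplicativity of \<delta> frees the letter again. *)
  obtain a as' where hd: "as = a # as'" using len by (cases as) auto
  have first: "?t 0 = \<delta> c * (\<delta> (hd as) * F (tl as)) * \<delta> d"
    using augment_pad [of F "c * a" as' d] by (simp add: hd counit_mult)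
  obtain as'' b where last: "as = as'' @ [b]" using len by (cases as rule: rev_cases) auto
  have "merge (n + 1) (c # as @ [d]) = c # as'' @ [b * d]"
    using merge_append_left [of "c # as''" 0 "[b, d]"] len by (simp add: last)
  then have final: "?t (n + 1) = \<delta> c * ((- 1) ^ (n + 1) * F (butlast as) * \<delta> (last as)) * \<delta> d"
    by (simp add: last counit_mult)
  have middle: "?t i = \<delta> c * ((- 1) ^ i * F (take (i - 1) as @ (as ! (i - 1) * as ! i) # drop (i + 1) as)) * \<delta> d"
    if i: "i \<in> {1..n}" for i
  proof -
    obtain j where j: "i = Suc j" using i by (cases i) auto
    have "merge i (c # as @ [d]) = c # merge j as @ [d]"
      using i len by (simp add: j merge_append_right)
    also have "\<dots> = c # (take j as @ (as ! j * as ! Suc j) # drop (j + 2) as) @ [d]"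
      using i len by (simp add: j merge_take_drop)
    finally show ?thesis by (simp only: augment_pad) (simp add: j)
  qed
  have "(\<Sum>i = 1..n. ?t i) = \<delta> c *
      (\<Sum>i = 1..n. (- 1) ^ i * F (take (i - 1) as @ (as ! (i - 1) * as ! i) # drop (i + 1) as)) * \<delta> d"
    unfolding sum_distrib_left sum_distrib_right by (rule sum.cong [OF refl]) (rule middle)
  then show ?thesis
    by (simp only: split first final distrib_left distrib_right)
qed

lemma coboundary_eq_tlift: "coboundary \<delta> n f = tlift (n + 1) (word_coboundary n (\<lambda>w. f (pure w)))"
  unfolding coboundary_def
  by (rule tlift_cong) (simp only: word_coboundary_def sum_augment_merge counit_one mult_1_left mult_1_right)

text \<open>
  The key formula: \<open>word_coboundary\<close> is defined by padding with units, but the formula holds for arbitrary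
  outer letters, because both sides depend on them only through a factor \<open>\<delta>(c) \<delta>(d)\<close>.
\<close>

lemma augment_word_coboundary:
  assumes "length w = n + 3"
  shows "augment (word_coboundary n F) w = (\<Sum>i\<le>n + 1. (- 1) ^ i * augment F (merge i w))"
proof -
  obtain c as d where "w = c # as @ [d]" "length as = n + 1"
    using assms word_cases [of w "n + 1"] by auto
  then show ?thesis
    using sum_augment_merge [of as n F c d] sum_augment_merge [of as n F 1 1]
    by (simp add: word_coboundary_def counit_one del: sum.atMost_Suc)
qed

lemma multilinear_word_coboundary:
  assumes "multilinear n F"
  shows "multilinear (n + 1) (word_coboundary n F)"
  unfolding word_coboundary_def
proof (intro multilinear_sum multilinear_cmult)
  fix i assume "i \<in> {..n + 1}"
  then have "multilinear (Suc (n + 2)) (\<lambda>w. augment F (merge i w))"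
    using assms by (intro multilinear_merge multilinear_augment) auto
  then show "multilinear (n + 1) (\<lambda>as. augment F (merge i (1 # as @ [1])))"
    by (intro multilinear_pad) simp
qed

lemma word_coboundary_cong:
  assumes "\<And>w. length w = n \<Longrightarrow> F w = F' w" "length as = n + 1"
  shows "word_coboundary n F as = word_coboundary n F' as"
  unfolding word_coboundary_def using assms
  by (intro sum.cong arg_cong2 [where f = "(*)"] augment_cong [of n]) (simp_all add: length_merge del: append_Cons)

lemma word_coboundary_add: "word_coboundary n (\<lambda>w. F w + F' w) as = word_coboundary n F as + word_coboundary n F' as"
  and word_coboundary_cmult: "word_coboundary n (\<lambda>w. c * F w) as = c * word_coboundary n F as"
  by (simp_all add: word_coboundary_def augment_add augment_cmult sum.distrib distrib_left sum_distrib_left mult.left_commute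
      del: sum.atMost_Suc)

lemma coboundary_cochain: "f \<in> cochains n \<Longrightarrow> coboundary \<delta> n f \<in> cochains (n + 1)"
  unfolding coboundary_eq_tlift by (intro tlift_cochain multilinear_word_coboundary multilinear_cochain)

lemma coboundary_pure_word:
  "f \<in> cochains n \<Longrightarrow> length w = n + 1 \<Longrightarrow> coboundary \<delta> n f (pure w) = word_coboundary n (\<lambda>w. f (pure w)) w"
  unfolding coboundary_eq_tlift
  by (simp only: tlift_pure [OF multilinear_word_coboundary [OF multilinear_cochain]] refl if_True)

lemma coboundary_add:
  assumes "f \<in> cochains n" "g \<in> cochains n"
  shows "coboundary \<delta> n (f + g) = coboundary \<delta> n f + coboundary \<delta> n g"
proof (rule cochains_eqI)
  show "coboundary \<delta> n (f + g) \<in> cochains (n + 1)"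
    "coboundary \<delta> n f + coboundary \<delta> n g \<in> cochains (n + 1)"
    by (intro coboundary_cochain cochains_add assms)+
  show "coboundary \<delta> n (f + g) (pure w) = (coboundary \<delta> n f + coboundary \<delta> n g) (pure w)"
    if "length w = n + 1" for w
    using coboundary_pure_word [OF cochains_add [OF assms] that]
    by (simp add: coboundary_pure_word [OF _ that] assms word_coboundary_add)
qed

lemma coboundary_scaleC:
  assumes "f \<in> cochains n"
  shows "coboundary \<delta> n (c *\<^sub>C f) = c *\<^sub>C coboundary \<delta> n f"
proof (rule cochains_eqI)
  show "coboundary \<delta> n (c *\<^sub>C f) \<in> cochains (n + 1)" "c *\<^sub>C coboundary \<delta> n f \<in> cochains (n + 1)"
    by (intro coboundary_cochain cochains_scaleC assms)+
  show "coboundary \<delta> n (c *\<^sub>C f) (pure w) = (c *\<^sub>C coboundary \<delta> n f) (pure w)"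
    if "length w = n + 1" for w
    using coboundary_pure_word [OF cochains_scaleC [OF assms, of c] that]
    by (simp add: coboundary_pure_word [OF assms that] word_coboundary_cmult scaleC_fun_def scaleC_complex_def)
qed

lemma word_coboundary_twice:
  assumes "length as = n + 2"
  shows "word_coboundary (n + 1) (word_coboundary n F) as = 0"
proof -
  let ?w = "1 # as @ [1]"
  have "word_coboundary (n + 1) (word_coboundary n F) as =
      (\<Sum>j\<le>n + 2. (- 1) ^ j * (\<Sum>i\<le>n + 1. (- 1) ^ i * augment F (merge i (merge j ?w))))"
    unfolding word_coboundary_def [of "n + 1"] using assms
    by (intro sum.cong arg_cong2 [where f = "(*)"] augment_word_coboundary) (simp_all add: length_merge del: append_Cons)
  also have "\<dots> = (\<Sum>j\<le>Suc (n + 1). \<Sum>i\<le>n + 1. (- 1) ^ (i + j) * augment F (merge i (merge j ?w)))"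
    by (simp add: sum_distrib_left power_add mult_ac del: sum.atMost_Suc)
  also have "\<dots> = 0"
    using assms by (intro alternating_double_sum arg_cong [where f = "augment F"] merge_merge) auto
  finally show ?thesis .
qed

lemma coboundary_coboundary:
  assumes "f \<in> cochains n"
  shows "coboundary \<delta> (n + 1) (coboundary \<delta> n f) = 0"
proof (rule cochains_eqI)
  show "coboundary \<delta> (n + 1) (coboundary \<delta> n f) \<in> cochains (n + 1 + 1)"
    by (intro coboundary_cochain assms)
  fix w :: "'b list" assume w: "length w = n + 1 + 1"
  have "coboundary \<delta> (n + 1) (coboundary \<delta> n f) (pure w) = word_coboundary (n + 1) (\<lambda>w. coboundary \<delta> n f (pure w)) w"
    by (rule coboundary_pure_word [OF coboundary_cochain [OF assms] w])
  also have "\<dots> = word_coboundary (n + 1) (word_coboundary n (\<lambda>w. f (pure w))) w"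
    by (rule word_coboundary_cong [OF _ w]) (rule coboundary_pure_word [OF assms])
  finally show "coboundary \<delta> (n + 1) (coboundary \<delta> n f) (pure w) = 0 (pure w)"
    using word_coboundary_twice [of w n] w by simp
qed (rule cochains_zero)

section \<open>The normalized commuting complex\<close>

lemma word_coboundary_ones:
  assumes "F (replicate n 1) = 0"
  shows "word_coboundary n F (replicate (n + 1) 1) = 0"
proof -
  have "1 # replicate (n + 1) 1 @ [1] = replicate (n + 3) (1::'b)"
    by (simp add: replicate_append_same [symmetric] numeral_3_eq_3)
  moreover have "augment F (replicate (n + 2) 1) = 0"
  proof -
    have "replicate (n + 2) (1::'b) = 1 # replicate n 1 @ [1]"
      by (simp add: replicate_append_same [symmetric])
    then show ?thesis using assms by (simp only: augment_pad) simp
  qed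
  ultimately show ?thesis by (simp add: word_coboundary_def merge_replicate del: sum.atMost_Suc append_Cons)
qed

text \<open>
  Each face of the padded word is again of the form \<open>c a\<^sub>1 \<dots> a\<^sub>n d\<close>, where both convolutions of
  \<open>augment F\<close> are those of \<open>F\<close> multiplied by \<open>c\<close> from the left and by \<open>d\<close> from the right.
\<close>

lemma conv_word_coboundary:
  assumes F: "multilinear n F"
    and comm: "\<And>as. length as = n \<Longrightarrow> conv_left F as = conv_right F as"
    and len: "length as = n + 1"
  shows "conv_left (word_coboundary n F) as = conv_right (word_coboundary n F) as"
proof -
  let ?w = "1 # as @ [1]"
  have lenw: "length ?w = n + 3" using len by simp
  have aug: "multilinear (n + 2) (augment F)" by (rule multilinear_augment [OF F])
  have expand: "length v = length ?w \<Longrightarrow>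
      augment (word_coboundary n F) v = (\<Sum>i\<le>n + 1. (- 1) ^ i * augment F (merge i v))" for v
    using len by (intro augment_word_coboundary) simp
  have ml: "i \<in> {..n + 1} \<Longrightarrow> multilinear (length ?w) (\<lambda>v. augment F (merge i v))" for i
    unfolding lenw using multilinear_merge [OF aug, of i] by (simp add: numeral_3_eq_3)
  have eq: "conv_left (augment F) (merge i ?w) = conv_right (augment F) (merge i ?w)"
    if "i \<le> n + 1" for i
  proof -
    have "length (merge i ?w) = n + 2" using that len by (subst length_merge) auto
    then obtain c bs d where "merge i ?w = c # bs @ [d]" "length bs = n" by (rule word_cases)
    then show ?thesis using F comm by (simp add: conv_left_augment conv_right_augment)
  qed
  (* Padding with units turns the coboundary into faces that all have the same shape. *)
  have "conv_left (word_coboundary n F) as = conv_left (augment (word_coboundary n F)) ?w"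
    using multilinear_word_coboundary [OF F] len by (simp add: conv_left_augment)
  also have "\<dots> = (\<Sum>i\<le>n + 1. (- 1) ^ i *\<^sub>C conv_left (\<lambda>v. augment F (merge i v)) ?w)"
    by (simp only: conv_cong(1) [OF expand] conv_lincomb(1) [OF ml])
  also have "\<dots> = (\<Sum>i\<le>n + 1. (- 1) ^ i *\<^sub>C conv_right (\<lambda>v. augment F (merge i v)) ?w)"
    using len by (intro sum.cong) (simp_all add: conv_merge [OF aug] eq del: append_Cons)
  also have "\<dots> = conv_right (augment (word_coboundary n F)) ?w"
    by (simp only: conv_cong(2) [OF expand] conv_lincomb(2) [OF ml])
  also have "\<dots> = conv_right (word_coboundary n F) as"
    using multilinear_word_coboundary [OF F] len by (simp add: conv_right_augment)
  finally show ?thesis .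
qed

lemma cochains_NC_cochains: "f \<in> cochains_NC \<Delta> n \<Longrightarrow> f \<in> cochains n"
  by (simp add: cochains_NC_def cochains_N_def)

lemma cochains_NC_iff:
  "f \<in> cochains_NC \<Delta> n \<longleftrightarrow> f \<in> cochains n \<and> f (pure (replicate n 1)) = 0 \<and>
    (\<forall>as. length as = n \<longrightarrow> conv_left (\<lambda>w. f (pure w)) as = conv_right (\<lambda>w. f (pure w)) as)"
  using cochains_C_iff by (auto simp: cochains_NC_def cochains_N_def)

lemma cochains_NC_zero: "0 \<in> cochains_NC \<Delta> n"
proof -
  have "conv_left (\<lambda>w. 0) as = conv_right (\<lambda>w. 0) as" for as
    by (simp add: conv_left_def conv_right_def)
  then show ?thesis by (simp add: cochains_NC_iff cochains_zero)
qed

lemma cochains_NC_add: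
  "f \<in> cochains_NC \<Delta> n \<Longrightarrow> g \<in> cochains_NC \<Delta> n \<Longrightarrow> f + g \<in> cochains_NC \<Delta> n"
  by (auto simp: cochains_NC_iff cochains_add conv_add multilinear_cochain)

lemma cochains_NC_scaleC: "f \<in> cochains_NC \<Delta> n \<Longrightarrow> c *\<^sub>C f \<in> cochains_NC \<Delta> n"
  by (auto simp: cochains_NC_iff cochains_scaleC)
    (simp add: scaleC_fun_def scaleC_complex_def conv_cmult multilinear_cochain)+

lemma coboundary_NC:
  assumes "f \<in> cochains_NC \<Delta> n"
  shows "coboundary \<delta> n f \<in> cochains_NC \<Delta> (n + 1)"
proof -
  have f: "f \<in> cochains n" using assms by (rule cochains_NC_cochains)
  have "coboundary \<delta> n f (pure (replicate (n + 1) 1)) = word_coboundary n (\<lambda>w. f (pure w)) (replicate (n + 1) 1)"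
    by (rule coboundary_pure_word [OF f]) simp
  also have "\<dots> = 0" using assms by (intro word_coboundary_ones) (simp add: cochains_NC_iff)
  finally have N: "coboundary \<delta> n f (pure (replicate (n + 1) 1)) = 0" .
  have C: "conv_left (\<lambda>w. coboundary \<delta> n f (pure w)) as = conv_right (\<lambda>w. coboundary \<delta> n f (pure w)) as"
    if as: "length as = n + 1" for as
  proof -
    have "length w = length as \<Longrightarrow> coboundary \<delta> n f (pure w) = word_coboundary n (\<lambda>w. f (pure w)) w" for w
      using as by (intro coboundary_pure_word [OF f]) simp
    note conv_cong [of as, OF this]
    moreover have "conv_left (word_coboundary n (\<lambda>w. f (pure w))) as = conv_right (word_coboundary n (\<lambda>w. f (pure w))) as"
      using assms as multilinear_cochain [OF f] by (intro conv_word_coboundary) (auto simp: cochains_NC_iff)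
    ultimately show ?thesis by simp
  qed
  show ?thesis unfolding cochains_NC_iff using coboundary_cochain [OF f] N C by blast
qed

lemma cochain_complex_NC: "cochain_complex scaleC (cochains_NC \<Delta>) (coboundary \<delta>)"
proof -
  interpret vector_space "scaleC :: complex \<Rightarrow> ('b tens \<Rightarrow> complex) \<Rightarrow> _" by (rule vector_space_scaleC)
  show ?thesis
  proof
    show "subspace (cochains_NC \<Delta> n)" for n
      unfolding subspace_def by (simp add: cochains_NC_zero cochains_NC_add cochains_NC_scaleC)
  qed (simp_all only: coboundary_NC coboundary_add coboundary_scaleC coboundary_coboundary cochains_NC_cochains)
qed

end

section \<open>The hermitian subcomplex\<close>

definition hermitian_sign :: "nat \<Rightarrow> complex" where
  "hermitian_sign n = (if odd \<lceil>real n / 2\<rceil> then 1 else - 1)"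

text \<open>
  The signs for \<open>n = 0, 1, 2, 3, 4, \<dots>\<close> are \<open>-, +, +, -, -, \<dots>\<close>: from \<open>n\<close> to \<open>n + 1\<close> they change
  exactly when \<open>n\<close> is even, which is when the coboundary anticommutes with \<open>tilde\<close>.
\<close>

lemma hermitian_sign_Suc: "hermitian_sign (n + 1) = (- 1) ^ (n + 1) * hermitian_sign n"
proof (cases "even n")
  case True
  then obtain k where n: "n = 2 * k" by blast
  have "\<lceil>real (n + 1) / 2\<rceil> = int k + 1" by (rule ceiling_unique) (simp_all add: n)
  moreover have "\<lceil>real n / 2\<rceil> = int k" by (simp add: n)
  ultimately show ?thesis by (simp add: hermitian_sign_def n)
next
  case False
  then obtain k where n: "n = 2 * k + 1" by (rule oddE)
  have "\<lceil>real n / 2\<rceil> = int k + 1" by (rule ceiling_unique) (simp_all add: n)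
  moreover have "\<lceil>real (n + 1) / 2\<rceil> = int k + 1" by (rule ceiling_unique) (simp_all add: n)
  ultimately show ?thesis by (simp add: hermitian_sign_def n)
qed

context star_bialgebra
begin

lemma star_one: "star 1 = 1"
  by (metis mult.left_neutral star_mult star_star)

lemma cochains_H_iff:
  assumes f: "f \<in> cochains n"
  shows "f \<in> cochains_H star n \<longleftrightarrow>
    (\<forall>as. length as = n \<longrightarrow> cnj (f (pure (map star (rev as)))) = hermitian_sign n * f (pure as))"
proof -
  let ?F = "\<lambda>as. cnj (f (pure (map star (rev as))))"
  have "multilinear n ?F"
    using f by (auto simp: multi_semilinear_def semilinear_def star_add star_scaleC pure_add pure_scaleC
      cochains_iff scaleC_complex_def)
  then have tilde: "tilde star n f \<in> cochains n" "length as = n \<Longrightarrow> tilde star n f (pure as) = ?F as" for as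
    by (simp_all add: tilde_def tlift_cochain tlift_pure)
  have "(\<lambda>x. hermitian_sign n * f x) \<in> cochains n"
    using cochains_scaleC [OF f, of "hermitian_sign n"] by (simp add: scaleC_fun_def scaleC_complex_def)
  then have "tilde star n f = (\<lambda>x. hermitian_sign n * f x) \<longleftrightarrow> (\<forall>as. length as = n \<longrightarrow> ?F as = hermitian_sign n * f (pure as))"
    using tilde by (auto intro!: cochains_eqI)
  moreover have "(\<lambda>x. hermitian_sign n * f x) = (if odd \<lceil>real n / 2\<rceil> then f else - f)"
    by (auto simp: hermitian_sign_def)
  ultimately show ?thesis using f by (simp add: cochains_H_def)
qed

lemma augment_star:
  assumes "length w = n + 2"
  shows "cnj (augment F (map star (rev w))) = augment (\<lambda>v. cnj (F (map star (rev v)))) w"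
proof -
  obtain c as d where "w = c # as @ [d]" using assms by (rule word_cases)
  then show ?thesis by (simp add: counit_star)
qed

text \<open>
  Reversal sends the \<open>i\<close>-th face to the \<open>(n+1-i)\<close>-th one; comparing the signs of these two faces yields
  the factor \<open>(-1)^(n+1)\<close>.
\<close>

lemma word_coboundary_star:
  assumes "length as = n + 1"
  shows "cnj (word_coboundary n F (map star (rev as))) = (- 1) ^ (n + 1) * word_coboundary n (\<lambda>v. cnj (F (map star (rev v)))) as"
proof -
  let ?w = "1 # as @ [1]" and ?F = "\<lambda>v. cnj (F (map star (rev v)))"
  have pad: "1 # map star (rev as) @ [1] = map star (rev ?w)" by (simp add: star_one)
  have "cnj (word_coboundary n F (map star (rev as))) =
      (\<Sum>i\<le>n + 1. (- 1) ^ i * cnj (augment F (merge i (map star (rev ?w)))))"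
    unfolding word_coboundary_def pad by simp
  also have "\<dots> = (\<Sum>i\<le>n + 1. (- 1) ^ (n + 1) * ((- 1) ^ (n + 1 - i) * augment ?F (merge (n + 1 - i) ?w)))"
  proof (intro sum.cong refl)
    fix i assume "i \<in> {..n + 1}"
    then have i: "i \<le> n + 1" by simp
    have "merge i (map star (rev ?w)) = map star (rev (merge (n + 1 - i) ?w))"
      using i assms by (intro merge_map_rev star_mult) simp
    moreover have "length (merge (n + 1 - i) ?w) = n + 2"
      using assms by (subst length_merge) auto
    moreover have "(- 1) ^ i = (- 1 :: complex) ^ (n + 1) * (- 1) ^ (n + 1 - i)"
      using i by (auto simp: minus_one_power_iff)
    ultimately show "(- 1) ^ i * cnj (augment F (merge i (map star (rev ?w)))) =
        (- 1) ^ (n + 1) * ((- 1) ^ (n + 1 - i) * augment ?F (merge (n + 1 - i) ?w))"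
      by (simp only: augment_star mult.assoc)
  qed
  also have "\<dots> = (- 1) ^ (n + 1) * (\<Sum>i\<le>n + 1. (- 1) ^ (n + 1 - i) * augment ?F (merge (n + 1 - i) ?w))"
    by (rule sum_distrib_left [symmetric])
  also have "(\<Sum>i\<le>n + 1. (- 1) ^ (n + 1 - i) * augment ?F (merge (n + 1 - i) ?w)) = word_coboundary n ?F as"
    unfolding word_coboundary_def by (rule sum.reindex_bij_witness [of _ "\<lambda>i. n + 1 - i" "\<lambda>i. n + 1 - i"]) auto
  finally show ?thesis .
qed

lemma coboundary_H:
  assumes f: "f \<in> cochains n" and H: "f \<in> cochains_H star n"
  shows "coboundary \<delta> n f \<in> cochains_H star (n + 1)"
  unfolding cochains_H_iff [OF coboundary_cochain [OF f]]
proof (intro allI impI)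
  fix as :: "'b list" assume as: "length as = n + 1"
  have "cnj (coboundary \<delta> n f (pure (map star (rev as)))) =
      (- 1) ^ (n + 1) * word_coboundary n (\<lambda>v. cnj (f (pure (map star (rev v))))) as"
    using as by (simp only: coboundary_pure_word [OF f] length_map length_rev word_coboundary_star)
  also have "word_coboundary n (\<lambda>v. cnj (f (pure (map star (rev v))))) as = word_coboundary n (\<lambda>v. hermitian_sign n * f (pure v)) as"
    using H as by (intro word_coboundary_cong) (auto simp: cochains_H_iff [OF f])
  also have "(- 1) ^ (n + 1) * \<dots> = hermitian_sign (n + 1) * coboundary \<delta> n f (pure as)"
    using as by (simp only: word_coboundary_cmult coboundary_pure_word [OF f] hermitian_sign_Suc mult.assoc)
  finally show "cnj (coboundary \<delta> n f (pure (map star (rev as)))) = hermitian_sign (n + 1) * coboundary \<delta> n f (pure as)" .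
qed

text \<open>Only real multiples remain hermitian, because \<open>tilde\<close> is conjugate-linear.\<close>

lemma cochains_H_zero: "0 \<in> cochains_H star n"
  and cochains_H_add:
    "f \<in> cochains_H star n \<Longrightarrow> g \<in> cochains_H star n \<Longrightarrow> f + g \<in> cochains_H star n"
  and cochains_H_scale:
    "f \<in> cochains_H star n \<Longrightarrow> complex_of_real r *\<^sub>C f \<in> cochains_H star n"
proof -
  have H: "f \<in> cochains_H star n \<Longrightarrow> f \<in> cochains n" for f by (simp add: cochains_H_def)
  show "0 \<in> cochains_H star n" by (simp add: cochains_H_iff cochains_zero)
  show "f \<in> cochains_H star n \<Longrightarrow> g \<in> cochains_H star n \<Longrightarrow> f + g \<in> cochains_H star n"
    using H [of f] H [of g] by (simp add: cochains_H_iff cochains_add distrib_left)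
  show "f \<in> cochains_H star n \<Longrightarrow> complex_of_real r *\<^sub>C f \<in> cochains_H star n"
    using H [of f] by (simp add: cochains_H_iff cochains_scaleC) (simp add: scaleC_fun_def scaleC_complex_def)
qed

lemma cochain_complex_NCH:
  "cochain_complex (\<lambda>r::real. scaleC (complex_of_real r)) (cochains_NCH \<Delta> star) (coboundary \<delta>)"
proof -
  interpret vector_space "\<lambda>r::real. scaleC (complex_of_real r) :: ('b tens \<Rightarrow> complex) \<Rightarrow> _"
    by unfold_locales (simp_all add: scaleC_add_right scaleC_add_left scaleC_scaleC scaleC_one)
  have NC: "f \<in> cochains_NCH \<Delta> star n \<Longrightarrow> f \<in> cochains n" for f n
    by (simp add: cochains_NCH_def cochains_NC_cochains)
  show ?thesis
  proof
    show "subspace (cochains_NCH \<Delta> star n)" for n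
      unfolding subspace_def cochains_NCH_def
      by (simp add: cochains_NC_zero cochains_NC_add cochains_NC_scaleC
        cochains_H_zero cochains_H_add cochains_H_scale)
    show "coboundary \<delta> n f \<in> cochains_NCH \<Delta> star (n + 1)" if "f \<in> cochains_NCH \<Delta> star n" for f n
      using that NC [OF that] coboundary_NC coboundary_H unfolding cochains_NCH_def by blast
  qed (simp_all only: NC coboundary_add coboundary_scaleC coboundary_coboundary)
qed

end

theorem mainTheorem8:
  fixes \<Delta> :: "'b::complex_algebra_1 \<Rightarrow> 'b tens" and \<delta> :: "'b \<Rightarrow> complex"
  assumes "bialgebra \<Delta> \<delta>"
  shows "cochain_complex scaleC (cochains_NC \<Delta>) (coboundary \<delta>)
    \<and> (\<forall>star. star_bialgebra \<Delta> \<delta> star \<longrightarrow>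
          cochain_complex (\<lambda>r::real. scaleC (complex_of_real r))
            (cochains_NCH \<Delta> star) (coboundary \<delta>))"
  using bialgebra.cochain_complex_NC [OF assms] star_bialgebra.cochain_complex_NCH by blast

end
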